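(* Let $n\ge1$, let $\mathfrak p_0\in A=\mathbb F_q[T]$ be monic irreducible of degree $r$ with $\gcd(n,r)=1$, let $t\in\mathbb F_{q^r}$ be a root of $\mathfrak p_0$, let $\phi$ be the Drinfeld module with $\phi_T=t+\tau^n$, let $\mathfrak p\neq\mathfrak p_0$ be a monic irreducible element of $A$ of degree $d$, and let $m\mid n$. With the notation and the choice of bases fixed in the context, for every $f\in R$, $$A_{\pi f}=Q\,A_f\,T.$$ Both $Q$ and $T$ are invertible. Consequently, for every code (left ideal) $C\subseteq R$, the matrix code $A(C)=\{A_f:f\in C\}$ is invariant under $A\mapsto QAT$ and under $A\mapsto M_\zeta A$, $\zeta\in L$.
   Context: $q$ is a prime power, $A=\mathbb F_q[T]$ (in the matrix statements, $T$ denotes the matrix below and $A$ a matrix), $\overline{\mathbb F}_q$ a fixed algebraic closure, $[i]=q^i$, $\beta^{[i]}=\beta^{q^i}$. Twisted polynomials in $\tau$ satisfy $\tau a=a^q\tau$ and act on $\overline{\mathbb F}_q$ with $\tau$ acting as $x\mapsto x^q$ and constants by multiplication. $\phi\colon\mathbb F_q[T]\to\mathbb F_{q^r}\{\tau\}$, $a\mapsto\phi_a$, is the $\mathbb F_q$-algebra homomorphism with $\phi_T=t+\tau^n$. Put $\kappa=\mathbb F_q[T]/\mathfrak p\cong\mathbb F_{q^d}$, $c=\mathfrak p_0\bmod\mathfrak p\in\kappa^\times$, and $M=\phi[\mathfrak p]=\{v\in\overline{\mathbb F}_q:\phi_{\mathfrak p}(v)=0\}$, a $\kappa$-vector space of dimension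 $n$ via $a\cdot v=\phi_a(v)$; $E=\operatorname{End}_\kappa(M)$; $\pi=\tau^r$, acting on $M$ by $v\mapsto v^{[r]}$; $S=\kappa[\pi|_M]$; $R_0=\kappa[\pi^m|_M]$; $R=\operatorname{Cent}_E(R_0)$ (centralizer); $L=\mathbb F_{q^m}\subseteq R$ acting on $M$ by scalar multiplication. Multiplication $L\otimes_{\mathbb F_q}S\to R$ is bijective. Bases. Note $\gcd(r,m)=1$. Fix $\theta\in L$ normal over $\mathbb F_q$, so that $\lambda_i=\theta^{[ri]}$, $0\le i<m$, is an $\mathbb F_q$-basis of $L$. Fix $\varepsilon\in\kappa$ normal over $\mathbb F_q$ and put $\varepsilon_\ell=\varepsilon^{[\ell]}$, $0\le\ell<d$ (powers in the field $\kappa$). The elements $s_{k,\ell}=\varepsilon_\ell\pi^k$, $0\le k<n$, $0\le\ell<d$, form an $\mathbb F_q$-basis of $S$. Every $f\in R$ is uniquely $f=\sum_{k,\ell}b_{k,\ell}s_{k,\ell}$ with $b_{k,\ell}\in L$; $A_f\in\operatorname{Mat}_{m\times nd}(\mathbb F_q)$ is the matrix with columns indexed by the pairs $(k,\ell)$ whose $(k,\ell)$ column is the coordinate vector of $b_{k,\ell}$ in the basis $(\lambda_i)$. Matrices. $Q\in\operatorname{Mat}_m(\mathbb F_q)$ is the permutation matrix of the cyclic shift $i\mapsto i+1$ of $\{0,\dots,m-1\}$ (indices modulo $m$), i.e. it sends the $i$-th standard column vector to the $(i+1)$-st. $T\in\operatorname{Mat}_{nd}(\mathbb F_q)$, with rows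 and columns indexed by pairs $(k,\ell)$, has entries $T_{(k,\ell),(k+1,\ell)}=1$ for $0\le k\le n-2$ and $T_{(n-1,\ell),(0,\ell')}=c_{\ell\ell'}$, where $c\,\varepsilon_\ell=\sum_{\ell'}c_{\ell\ell'}\varepsilon_{\ell'}$ in $\kappa$ with $c_{\ell\ell'}\in\mathbb F_q$; all other entries are zero. For $\zeta\in L$, $M_\zeta\in\operatorname{Mat}_m(\mathbb F_q)$ is the matrix of multiplication by $\zeta$ on $L$ in the basis $(\lambda_i)$. *)

theory Defs
  imports
    "HOL-Library.Cardinality"
    "HOL-Algebra.Algebraic_Closure_Type"
    "HOL-Algebra.Generated_Rings"
    "HOL-Algebra.AbelCoset"
    "HOL-Number_Theory.Cong"
    "Jordan_Normal_Form.Matrix"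
begin

text \<open>
  The field with \<open>q\<close> elements is a type \<open>'k :: {field, finite}\<close>, so \<open>q = CARD('k)\<close> and
  \<open>A = 'k poly\<close>; the fixed algebraic closure is the library type \<open>'k alg_closure\<close>.
\<close>

definition frob :: "nat \<Rightarrow> 'k :: {field, finite} alg_closure \<Rightarrow> 'k alg_closure" where
  "frob i x = x ^ (CARD('k) ^ i)"

definition Fq_ext :: "nat \<Rightarrow> 'k :: {field, finite} alg_closure set" where
  "Fq_ext i = {x. frob i x = x}"


subsection \<open>Twisted polynomials and Drinfeld modules\<close>

text \<open>
  A twisted polynomial \<open>\<Sum> a\<^sub>i \<tau>^i\<close> is stored as the ordinary polynomial with the same
  coefficients. Addition agrees, but the product is \<open>twist_mult\<close> (\<open>\<tau>^i b = b^(q^i) \<tau>^i\<close>) and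
  the action on the algebraic closure is \<open>twist_act\<close>, not \<open>poly\<close>.
\<close>

definition twist_mult ::
  "'k :: {field, finite} alg_closure poly \<Rightarrow> 'k alg_closure poly \<Rightarrow> 'k alg_closure poly" where
  "twist_mult f g =
     (\<Sum>i\<le>degree f. \<Sum>j\<le>degree g. monom (coeff f i * frob i (coeff g j)) (i + j))"

definition twist_act ::
  "'k :: {field, finite} alg_closure poly \<Rightarrow> 'k alg_closure \<Rightarrow> 'k alg_closure" where
  "twist_act f v = (\<Sum>i\<le>degree f. coeff f i * frob i v)"

definition twisted_alg_hom ::
  "nat \<Rightarrow> ('k :: {field, finite} poly \<Rightarrow> 'k alg_closure poly) \<Rightarrow> bool" where
  "twisted_alg_hom r \<phi> \<longleftrightarrow>
     (\<forall>a i. coeff (\<phi> a) i \<in> Fq_ext r) \<and>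
     (\<forall>a b. \<phi> (a + b) = \<phi> a + \<phi> b) \<and>
     (\<forall>a b. \<phi> (a * b) = twist_mult (\<phi> a) (\<phi> b)) \<and>
     (\<forall>x. \<phi> [:x:] = [:to_ac x:])"

text \<open>For given \<open>t\<close> in \<open>Fq_ext r\<close> and \<open>n\<close>, exactly one \<open>\<phi>\<close> satisfies this predicate.\<close>

definition is_drinfeld_module ::
  "nat \<Rightarrow> nat \<Rightarrow> 'k :: {field, finite} alg_closure \<Rightarrow>
     ('k poly \<Rightarrow> 'k alg_closure poly) \<Rightarrow> bool" where
  "is_drinfeld_module r n t \<phi> \<longleftrightarrow>
     twisted_alg_hom r \<phi> \<and> \<phi> (monom 1 1) = [:t:] + monom 1 n"

definition torsion ::
  "('k :: {field, finite} poly \<Rightarrow> 'k alg_closure poly) \<Rightarrow> 'k poly \<Rightarrow> 'k alg_closure set" where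
  "torsion \<phi> p = {v. twist_act (\<phi> p) v = 0}"


subsection \<open>Endomorphisms of the torsion module\<close>

text \<open>
  Elements of \<open>\<kappa> = A/(p)\<close> are given by arbitrary representatives in \<open>'k poly\<close>, and equality
  in \<open>\<kappa>\<close> is congruence modulo \<open>p\<close>. Since \<open>\<phi>\<^sub>p\<close> kills \<open>torsion \<phi> p\<close>, being \<open>\<kappa>\<close>-linear there
  means commuting with all \<open>\<phi>\<^sub>a\<close>. Endomorphisms are extensional functions
  (\<open>undefined\<close> off the module), so that equality of functions is equality on the module.
\<close>

definition End_tors ::
  "('k :: {field, finite} poly \<Rightarrow> 'k alg_closure poly) \<Rightarrow> 'k poly \<Rightarrow>
     ('k alg_closure \<Rightarrow> 'k alg_closure) ring" where
  "End_tors \<phi> p =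
     \<lparr> carrier = {f \<in> torsion \<phi> p \<rightarrow>\<^sub>E torsion \<phi> p.
          (\<forall>v\<in>torsion \<phi> p. \<forall>w\<in>torsion \<phi> p. f (v + w) = f v + f w) \<and>
          (\<forall>a. \<forall>v\<in>torsion \<phi> p. f (twist_act (\<phi> a) v) = twist_act (\<phi> a) (f v))},
       monoid.mult = compose (torsion \<phi> p),
       one = (\<lambda>v\<in>torsion \<phi> p. v),
       ring.zero = (\<lambda>v\<in>torsion \<phi> p. 0),
       add = (\<lambda>f g. \<lambda>v\<in>torsion \<phi> p. f v + g v) \<rparr>"

definition kappa_act ::
  "('k :: {field, finite} poly \<Rightarrow> 'k alg_closure poly) \<Rightarrow> 'k poly \<Rightarrow> 'k poly \<Rightarrow>
     'k alg_closure \<Rightarrow> 'k alg_closure" where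
  "kappa_act \<phi> p a = (\<lambda>v\<in>torsion \<phi> p. twist_act (\<phi> a) v)"

definition L_act ::
  "('k :: {field, finite} poly \<Rightarrow> 'k alg_closure poly) \<Rightarrow> 'k poly \<Rightarrow> 'k alg_closure \<Rightarrow>
     'k alg_closure \<Rightarrow> 'k alg_closure" where
  "L_act \<phi> p \<zeta> = (\<lambda>v\<in>torsion \<phi> p. \<zeta> * v)"

definition frob_end ::
  "('k :: {field, finite} poly \<Rightarrow> 'k alg_closure poly) \<Rightarrow> 'k poly \<Rightarrow> nat \<Rightarrow>
     'k alg_closure \<Rightarrow> 'k alg_closure" where
  "frob_end \<phi> p r = (\<lambda>v\<in>torsion \<phi> p. frob r v)"

definition kappa_adjoin ::
  "('k :: {field, finite} poly \<Rightarrow> 'k alg_closure poly) \<Rightarrow> 'k poly \<Rightarrow>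
     ('k alg_closure \<Rightarrow> 'k alg_closure) \<Rightarrow> ('k alg_closure \<Rightarrow> 'k alg_closure) set" where
  "kappa_adjoin \<phi> p g = generate_ring (End_tors \<phi> p) (insert g (range (kappa_act \<phi> p)))"

definition centralizer :: "('a, 'b) ring_scheme \<Rightarrow> 'a set \<Rightarrow> ('a, 'b) ring_scheme" where
  "centralizer E B =
     E \<lparr> carrier := {f \<in> carrier E. \<forall>g\<in>B. f \<otimes>\<^bsub>E\<^esub> g = g \<otimes>\<^bsub>E\<^esub> f} \<rparr>"

definition code_ring ::
  "('k :: {field, finite} poly \<Rightarrow> 'k alg_closure poly) \<Rightarrow> 'k poly \<Rightarrow> nat \<Rightarrow> nat \<Rightarrow>
     ('k alg_closure \<Rightarrow> 'k alg_closure) ring" where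
  "code_ring \<phi> p r m =
     centralizer (End_tors \<phi> p)
       (kappa_adjoin \<phi> p (frob_end \<phi> p r [^]\<^bsub>End_tors \<phi> p\<^esub> m))"

definition left_ideal :: "'a set \<Rightarrow> ('a, 'b) ring_scheme \<Rightarrow> bool" where
  "left_ideal C R \<longleftrightarrow>
     additive_subgroup C R \<and> (\<forall>f\<in>carrier R. \<forall>g\<in>C. f \<otimes>\<^bsub>R\<^esub> g \<in> C)"


subsection \<open>Bases and coordinates\<close>

definition normal_in_ext :: "nat \<Rightarrow> 'k :: {field, finite} alg_closure \<Rightarrow> bool" where
  "normal_in_ext m \<theta> \<longleftrightarrow>
     \<theta> \<in> Fq_ext m \<and>
     (\<forall>\<beta>\<in>Fq_ext m. \<exists>!x. x \<in> carrier_vec m \<and> \<beta> = (\<Sum>i<m. to_ac (x $ i) * frob i \<theta>))"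

definition normal_mod :: "'k :: {field, finite} poly \<Rightarrow> 'k poly \<Rightarrow> bool" where
  "normal_mod p \<epsilon> \<longleftrightarrow>
     (\<forall>a. \<exists>!x. x \<in> carrier_vec (degree p) \<and>
        [a = (\<Sum>l<degree p. smult (x $ l) (\<epsilon> ^ (CARD('k) ^ l)))] (mod p))"

text \<open>
  The basis of \<open>L = Fq_ext m\<close> used for coordinates is ordered as \<open>\<lambda>\<^sub>i = \<theta>^(q^(r i))\<close>,
  \<open>0 \<le> i < m\<close>; this is a reordering of the conjugates of \<open>\<theta>\<close> because \<open>r\<close> and \<open>m\<close> are coprime.
\<close>

definition L_coords ::
  "nat \<Rightarrow> nat \<Rightarrow> 'k :: {field, finite} alg_closure \<Rightarrow> 'k alg_closure \<Rightarrow> 'k vec" where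
  "L_coords r m \<theta> \<beta> =
     (THE x. x \<in> carrier_vec m \<and> \<beta> = (\<Sum>i<m. to_ac (x $ i) * frob (r * i) \<theta>))"

definition kappa_coords ::
  "'k :: {field, finite} poly \<Rightarrow> 'k poly \<Rightarrow> 'k poly \<Rightarrow> 'k vec" where
  "kappa_coords p \<epsilon> a =
     (THE x. x \<in> carrier_vec (degree p) \<and>
        [a = (\<Sum>l<degree p. smult (x $ l) (\<epsilon> ^ (CARD('k) ^ l)))] (mod p))"

definition S_basis ::
  "('k :: {field, finite} poly \<Rightarrow> 'k alg_closure poly) \<Rightarrow> 'k poly \<Rightarrow> nat \<Rightarrow> 'k poly \<Rightarrow>
     nat \<Rightarrow> nat \<Rightarrow> 'k alg_closure \<Rightarrow> 'k alg_closure" where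
  "S_basis \<phi> p r \<epsilon> k l =
     kappa_act \<phi> p (\<epsilon> ^ (CARD('k) ^ l))
       \<otimes>\<^bsub>End_tors \<phi> p\<^esub> (frob_end \<phi> p r [^]\<^bsub>End_tors \<phi> p\<^esub> k)"

definition L_coeffs ::
  "('k :: {field, finite} poly \<Rightarrow> 'k alg_closure poly) \<Rightarrow> 'k poly \<Rightarrow> nat \<Rightarrow> nat \<Rightarrow> nat \<Rightarrow>
     'k poly \<Rightarrow> ('k alg_closure \<Rightarrow> 'k alg_closure) \<Rightarrow> nat \<times> nat \<Rightarrow> 'k alg_closure" where
  "L_coeffs \<phi> p r n m \<epsilon> f =
     (THE b. b \<in> {..<n} \<times> {..<degree p} \<rightarrow>\<^sub>E Fq_ext m \<and>
        f = finsum (End_tors \<phi> p)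
              (\<lambda>(k, l). L_act \<phi> p (b (k, l)) \<otimes>\<^bsub>End_tors \<phi> p\<^esub> S_basis \<phi> p r \<epsilon> k l)
              ({..<n} \<times> {..<degree p}))"


subsection \<open>Matrices\<close>

text \<open>
  With \<open>d = degree p\<close>, the index pair \<open>(k, l)\<close>, \<open>k < n\<close>, \<open>l < d\<close>, is flattened to \<open>k * d + l\<close>;
  conversely \<open>j\<close> stands for \<open>(j div d, j mod d)\<close>.
\<close>

definition code_mat ::
  "('k :: {field, finite} poly \<Rightarrow> 'k alg_closure poly) \<Rightarrow> 'k poly \<Rightarrow> nat \<Rightarrow> nat \<Rightarrow> nat \<Rightarrow>
     'k alg_closure \<Rightarrow> 'k poly \<Rightarrow> ('k alg_closure \<Rightarrow> 'k alg_closure) \<Rightarrow> 'k mat" where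
  "code_mat \<phi> p r n m \<theta> \<epsilon> f =
     mat m (n * degree p)
       (\<lambda>(i, j). L_coords r m \<theta>
          (L_coeffs \<phi> p r n m \<epsilon> f (j div degree p, j mod degree p)) $ i)"

definition shift_mat :: "nat \<Rightarrow> 'k :: {field, finite} mat" where
  "shift_mat m = mat m m (\<lambda>(i, j). if i = (j + 1) mod m then 1 else 0)"

text \<open>
  The last block row is multiplication by \<open>c = p0 mod p\<close>: the row of \<open>(n - 1, l)\<close> holds the
  coordinates of \<open>c \<epsilon>\<^sub>l\<close>. For \<open>n = 1\<close> it is the whole matrix.
\<close>

definition T_mat ::
  "'k :: {field, finite} poly \<Rightarrow> 'k poly \<Rightarrow> nat \<Rightarrow> 'k poly \<Rightarrow> 'k mat" where
  "T_mat p0 p n \<epsilon> =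
     (let d = degree p in
      mat (n * d) (n * d)
        (\<lambda>(i, j).
           let k = i div d; l = i mod d; k' = j div d; l' = j mod d in
           if k' = k + 1 then (if l = l' then 1 else 0)
           else if k = n - 1 \<and> k' = 0
             then kappa_coords p \<epsilon> (p0 * \<epsilon> ^ (CARD('k) ^ l)) $ l'
           else 0))"

definition L_mult_mat ::
  "nat \<Rightarrow> nat \<Rightarrow> 'k :: {field, finite} alg_closure \<Rightarrow> 'k alg_closure \<Rightarrow> 'k mat" where
  "L_mult_mat r m \<theta> \<zeta> =
     mat m m (\<lambda>(i, j). L_coords r m \<theta> (\<zeta> * frob (r * j) \<theta>) $ i)"

end

theory Submission
  imports Defs "Jordan_Normal_Form.Determinant"
begin

text \<open>
  Write \<open>q\<close> for the number of elements of the ground field, \<open>d\<close> for the degree of \<open>p\<close>, \<open>M = \<phi>[p]\<close> and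
  \<open>\<pi> = \<tau>^r\<close>. In coordinates the theorem is a short computation. If \<open>f = \<Sum> b(k,l) \<epsilon>\<^sub>l \<pi>^k\<close> with \<open>b(k,l)\<close> in
  \<open>L\<close>, then \<open>\<pi> f = \<Sum> b(k,l)^(q^r) \<epsilon>\<^sub>l \<pi>^(k+1)\<close>. Raising to the power \<open>q^r\<close> shifts the coordinates with
  respect to \<open>\<theta>^(q^(r i))\<close> cyclically, which is left multiplication by \<open>Q\<close>. Raising \<open>k\<close> by one, with
  the wrap-around \<open>\<pi>^n = c\<close>, is right multiplication by \<open>T\<close>. Left multiplication by \<open>\<zeta>\<close> in \<open>L\<close> acts on
  each coefficient separately, hence by \<open>M\<^sub>\<zeta>\<close>. The matrices are invertible because \<open>Q\<close> permutes the rows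
  and \<open>c\<close> is a unit of \<open>\<kappa>\<close>. A left ideal absorbs \<open>\<pi>\<close> and \<open>\<zeta>\<close>, which lie in \<open>R\<close>, and this gives the
  invariance of codes.

  The substance is that the coordinates exist and are unique and that \<open>\<pi>^n = c\<close>.

  The relation \<open>\<pi>^n = \<phi>(p0)\<close> (lemma \<open>act_p0\<close>) holds as an identity of operators on the whole algebraic
  closure. Over the closure \<open>p0\<close> splits as the product of \<open>X - t^(q^(n j))\<close>, \<open>j < r\<close>, since \<open>n\<close> is prime
  to \<open>r\<close>. Evaluate partial products at \<open>\<phi>\<^sub>T = t + \<tau>^n\<close> with all coefficients written on the left.
  Each factor multiplies on the right by \<open>\<phi>\<^sub>T\<close> and subtracts \<open>t^(q^(n j))\<close> on the left, and this turns
  \<open>\<tau>^(n j)\<close> into \<open>\<tau>^(n (j+1))\<close>.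

  For uniqueness of coordinates it is convenient to allow coefficients in the larger field
  \<open>F\<close> with \<open>q^n\<close> elements. Suppose that \<open>\<Sum> b(k,l) \<epsilon>\<^sub>l \<pi>^k\<close> vanishes on \<open>M\<close>. Its value at \<open>\<zeta> v\<close>, for fixed
  \<open>v\<close>, is a twisted polynomial in \<open>\<zeta>\<close> of \<open>\<tau>\<close>-degree less than \<open>n\<close> that vanishes on \<open>F\<close>, so each \<open>k\<close>
  contributes zero. What remains is a combination of \<open>\<phi>(X^j)\<close>, \<open>j < d\<close>. It has \<open>\<tau>\<close>-degree less than
  \<open>n d\<close> but vanishes on the \<open>q^(n d)\<close> elements of \<open>M\<close>, so it is zero (lemma \<open>crossed_inj\<close>).

  Existence follows by counting. There are \<open>(q^n)^(n d)\<close> families \<open>b\<close> with values in \<open>F\<close>, and \<open>M\<close> is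
  generated over \<open>\<kappa>\<close> by \<open>n\<close> elements, so it has at most \<open>(q^(n d))^n\<close> endomorphisms. Hence every
  endomorphism has coordinates in \<open>F\<close> (lemma \<open>crossed_surj_E\<close>). One that commutes with \<open>\<pi>^m\<close> has
  coordinates fixed by \<open>x \<mapsto> x^(q^(r m))\<close>, and as \<open>gcd (r m) n = m\<close> they lie in \<open>L\<close>
  (lemma \<open>crossed_surj\<close>).
\<close>

section \<open>Frobenius powers and finite fields inside the algebraic closure\<close>

lemma card_field_ge_2: "CARD('k::{field,finite}) \<ge> 2"
proof -
  have "card {0, 1 :: 'k} \<le> CARD('k)" by (intro card_mono) auto
  then show ?thesis by simp
qed

lemma card_field_gt_0: "CARD('k::{field,finite}) > 0" and card_field_gt_1: "CARD('k::{field,finite}) > Suc 0"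
  using card_field_ge_2[where 'k='k] by auto

text \<open>
  Multiplication by a nonzero element permutes the nonzero elements, so it preserves their product.
\<close>

lemma field_power_card:
  fixes x :: "'k :: {field, finite}"
  shows "x ^ CARD('k) = x"
proof (cases "x = 0")
  case False
  have "bij_betw (\<lambda>y. x * y) (UNIV - {0}) (UNIV - {0})"
    by (rule bij_betwI[of _ _ _ "\<lambda>y. y / x"]) (use False in auto)
  then have "(\<Prod>y\<in>UNIV - {0}. x * y) = \<Prod>(UNIV - {0})"
    by (rule prod.reindex_bij_betw)
  then have "x ^ (CARD('k) - 1) * \<Prod>(UNIV - {0}) = \<Prod>(UNIV - {0 :: 'k})"
    by (simp add: prod.distrib)
  then have "x ^ (CARD('k) - 1) = 1" by auto
  then show ?thesis using card_field_gt_0[where 'k='k]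
    by (metis mult.right_neutral power_eq_if not_gr_zero)
qed (use card_field_gt_0[where 'k='k] in \<open>simp add: power_0_left\<close>)

text \<open>
  Translation by 1 permutes the field, so it preserves the sum of all elements.
\<close>

lemma of_nat_card_field: "of_nat CARD('k) = (0 :: 'k :: {field, finite} alg_closure)"
proof -
  have "(\<Sum>x\<in>UNIV. x) = (\<Sum>x\<in>UNIV. x + (1::'k))"
    by (rule sum.reindex_bij_witness[of _ "\<lambda>x. x + 1" "\<lambda>x. x - 1"]) auto
  then have "of_nat CARD('k) = (0 :: 'k)" by (simp add: sum.distrib)
  then have "to_ac (of_nat CARD('k) :: 'k) = 0" by simp
  then show ?thesis by (simp only: to_ac_of_nat)
qed

lemma poly_map_poly_to_ac_simps [simp]:
  "map_poly to_ac 0 = 0"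
  "map_poly to_ac (pCons a P) = pCons (to_ac a) (map_poly to_ac P)"
  by (simp_all add: map_poly_pCons)

lemma map_poly_to_ac_add: "map_poly to_ac (P + Q) = map_poly to_ac P + map_poly to_ac Q"
  by (rule poly_eqI) (simp add: coeff_map_poly)

lemma map_poly_to_ac_smult: "map_poly to_ac (smult c P) = smult (to_ac c) (map_poly to_ac P)"
  by (rule poly_eqI) (simp add: coeff_map_poly)

lemma map_poly_to_ac_mult: "map_poly to_ac (P * Q) = map_poly to_ac P * map_poly to_ac Q"
  by (induction P) (simp_all add: map_poly_to_ac_add map_poly_to_ac_smult)

lemma map_poly_to_ac_power: "map_poly to_ac (P ^ i) = map_poly to_ac P ^ i"
  by (induction i) (simp_all add: map_poly_to_ac_mult)

text \<open>
  Over the ground field, \<open>(X + 1)^q\<close> and \<open>X^q + 1\<close> are monic of degree \<open>q\<close> and agree at all \<open>q\<close> points,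
  hence they are equal as polynomials, and the identity persists in every extension.
\<close>

lemma power_card_add_1: "(x + 1) ^ CARD('k) = x ^ CARD('k) + (1 :: 'k :: {field, finite} alg_closure)"
proof -
  let ?q = "CARD('k)"
  have "[:1, 1:] ^ ?q = monom 1 ?q + (1 :: 'k poly)"
  proof (rule poly_eqI_degree_lead_coeff[where A = UNIV and n = ?q])
    show "coeff ([:1, 1:] ^ ?q) ?q = coeff (monom 1 ?q + (1 :: 'k poly)) ?q"
      using card_field_gt_0[where 'k='k] by (simp add: coeff_linear_power)
    show "degree (monom 1 ?q + (1 :: 'k poly)) \<le> ?q"
      by (intro degree_add_le) (simp_all add: degree_monom_le)
  qed (auto simp: degree_power_eq poly_monom field_power_card)
  then have "map_poly to_ac ([:1, 1:] ^ ?q) = map_poly to_ac (monom 1 ?q + (1 :: 'k poly))"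
    by simp
  then have "poly ([:1, 1:] ^ ?q) x = poly (monom 1 ?q + 1) x"
    by (simp add: map_poly_to_ac_power map_poly_to_ac_add map_poly_monom)
  then show ?thesis by (simp add: poly_monom add.commute)
qed

lemma power_card_add:
  fixes x y :: "'k :: {field, finite} alg_closure"
  shows "(x + y) ^ CARD('k) = x ^ CARD('k) + y ^ CARD('k)"
proof (cases "y = 0")
  case False
  then have "(x + y) ^ CARD('k) = (y * (x / y + 1)) ^ CARD('k)"
    by (simp add: field_simps)
  also have "\<dots> = y ^ CARD('k) * ((x / y) ^ CARD('k) + 1)"
    by (simp only: power_mult_distrib power_card_add_1)
  also have "\<dots> = x ^ CARD('k) + y ^ CARD('k)"
    using False by (simp add: power_divide distrib_left)
  finally show ?thesis .
qed (use card_field_gt_0[where 'k='k] in \<open>simp add: power_0_left\<close>)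

lemma frob_0_left [simp]: "frob 0 x = x"
  by (simp add: frob_def)

lemma frob_Suc: "frob (Suc i) (x :: 'k :: {field, finite} alg_closure) = frob i x ^ CARD('k)"
  by (simp add: frob_def power_mult mult.commute flip: power_mult)

lemma frob_frob [simp]: "frob i (frob j x) = frob (i + j) x"
  by (simp add: frob_def power_add power_mult mult.commute flip: power_mult)

lemma frob_commute: "frob i (frob j x) = frob j (frob i x)"
  by (simp add: add.commute)

lemma frob_add [simp]: "frob i (x + y) = frob i x + frob i y"
  by (induction i) (simp_all add: frob_Suc power_card_add)

lemma frob_mult [simp]: "frob i (x * y) = frob i x * frob i y"
  by (simp add: frob_def power_mult_distrib)

lemma frob_zero [simp]: "frob i 0 = 0"
  using frob_add[of i 0 0] by (metis add_cancel_right_left)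

lemma frob_minus [simp]: "frob i (- x) = - frob i x"
  using frob_add[of i x "- x"] by (simp add: minus_unique)

lemma frob_diff [simp]: "frob i (x - y) = frob i x - frob i y"
  using frob_add[of i x "- y"] by simp

lemma frob_sum: "frob i (sum f A) = (\<Sum>a\<in>A. frob i (f a))"
  by (induction A rule: infinite_finite_induct) simp_all

lemma frob_to_ac [simp]: "frob i (to_ac x) = to_ac x"
  by (induction i) (simp_all add: frob_Suc field_power_card flip: to_ac_power)

lemma frob_eq_0_iff [simp]: "frob i x = 0 \<longleftrightarrow> x = 0"
  by (auto simp: frob_def)

lemma inj_frob: "inj (frob i)"
proof (rule injI)
  fix x y :: "'a alg_closure" assume "frob i x = frob i y"
  then have "frob i (x - y) = 0" by (simp only: frob_diff diff_self)
  then show "x = y" by (simp only: frob_eq_0_iff right_minus_eq)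
qed

lemma Fq_ext_zero [simp]: "0 \<in> Fq_ext i" and Fq_ext_to_ac [simp]: "to_ac c \<in> Fq_ext i"
  and Fq_ext_diff: "x \<in> Fq_ext i \<Longrightarrow> y \<in> Fq_ext i \<Longrightarrow> x - y \<in> Fq_ext i"
  and Fq_ext_mult: "x \<in> Fq_ext i \<Longrightarrow> y \<in> Fq_ext i \<Longrightarrow> x * y \<in> Fq_ext i"
  and Fq_ext_sum: "(\<And>a. a \<in> A \<Longrightarrow> f a \<in> Fq_ext i) \<Longrightarrow> sum f A \<in> Fq_ext i"
  and Fq_ext_frob: "x \<in> Fq_ext i \<Longrightarrow> frob j x \<in> Fq_ext i"
  by (simp_all add: Fq_ext_def frob_sum) (metis frob_commute frob_frob)

lemma Fq_ext_mult_index: "x \<in> Fq_ext i \<Longrightarrow> frob (i * j) x = x"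
  by (induction j) (simp_all add: Fq_ext_def flip: frob_frob)

lemma Fq_ext_mono: "i dvd j \<Longrightarrow> Fq_ext i \<subseteq> Fq_ext j"
  using Fq_ext_mult_index by (auto simp: Fq_ext_def elim!: dvdE)

lemma Fq_ext_add_multiple: "x \<in> Fq_ext i \<Longrightarrow> frob (j + i * k) x = frob j x"
  by (metis Fq_ext_mult_index frob_frob)

lemma frob_mod: "x \<in> Fq_ext i \<Longrightarrow> frob (j mod i) x = frob j x"
  by (metis Fq_ext_add_multiple mod_mult_div_eq)

lemma Fq_ext_gcd:
  assumes "x \<in> Fq_ext i" "x \<in> Fq_ext j"
  shows "x \<in> Fq_ext (gcd i j)"
proof (cases "i = 0")
  case False
  then obtain a b where "i * a = j * b + gcd i j" using bezout_nat by blast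
  then have "frob (gcd i j) x = frob (i * a) x"
    using Fq_ext_add_multiple[OF assms(2)] by (simp add: add.commute)
  then show ?thesis using Fq_ext_mult_index[OF assms(1)] by (simp add: Fq_ext_def)
qed (use assms in simp)

section \<open>Twisted polynomials and the size of their kernels\<close>

lemma twist_act_bound:
  assumes "degree f \<le> N"
  shows "twist_act f v = (\<Sum>i\<le>N. coeff f i * frob i v)"
  unfolding twist_act_def using assms
  by (intro sum.mono_neutral_left) (auto simp: coeff_eq_0)

lemma twist_act_0 [simp]: "twist_act 0 v = 0"
  by (simp add: twist_act_def)

lemma twist_act_const [simp]: "twist_act [:c:] v = c * v"
  by (simp add: twist_act_def)

lemma twist_act_add: "twist_act (f + g) v = twist_act f v + twist_act g v"
proof -
  let ?N = "max (degree f) (degree g)"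
  have "degree (f + g) \<le> ?N" by (rule degree_add_le_max)
  then show ?thesis
    by (simp add: twist_act_bound[of _ ?N] distrib_right sum.distrib)
qed

lemma twist_act_sum: "twist_act (sum f A) v = (\<Sum>a\<in>A. twist_act (f a) v)"
  by (induction A rule: infinite_finite_induct) (simp_all add: twist_act_add)

lemma twist_act_monom: "twist_act (monom c i) v = c * frob i v"
proof -
  have "twist_act (monom c i) v = (\<Sum>j\<le>i. if j = i then c * frob i v else 0)"
    unfolding twist_act_bound[OF degree_monom_le] by (intro sum.cong) auto
  then show ?thesis by simp
qed

lemma twist_act_zero [simp]: "twist_act f 0 = 0"
  by (simp add: twist_act_def)

lemma twist_act_plus: "twist_act f (v + w) = twist_act f v + twist_act f w"
  by (simp add: twist_act_def distrib_left sum.distrib)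

lemma twist_act_minus: "twist_act f (- v) = - twist_act f v"
  by (simp add: twist_act_def sum_negf)

lemma twist_act_sum_right: "twist_act f (sum g A) = (\<Sum>a\<in>A. twist_act f (g a))"
  by (induction A rule: infinite_finite_induct) (simp_all add: twist_act_plus)

lemma twist_act_mult: "twist_act (twist_mult f g) v = twist_act f (twist_act g v)"
proof -
  have "twist_act (twist_mult f g) v
      = (\<Sum>i\<le>degree f. \<Sum>j\<le>degree g. coeff f i * frob i (coeff g j) * frob (i + j) v)"
    by (simp add: twist_mult_def twist_act_sum twist_act_monom)
  also have "\<dots> = twist_act f (twist_act g v)"
    by (simp add: twist_act_def frob_sum sum_distrib_left mult.assoc)
  finally show ?thesis .
qed

lemma coeff_twist_mult_0: "coeff (twist_mult f g) 0 = coeff f 0 * coeff g 0"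
proof -
  have "coeff (twist_mult f g) 0
      = (\<Sum>i\<le>degree f. \<Sum>j\<le>degree g. if j = 0 then (if i = 0 then coeff f 0 * coeff g 0 else 0) else 0)"
    unfolding twist_mult_def coeff_sum by (intro sum.cong refl) auto
  also have "\<dots> = coeff f 0 * coeff g 0" by (simp add: sum.delta)
  finally show ?thesis .
qed

lemma degree_twist_mult_le: "degree (twist_mult f g) \<le> degree f + degree g"
  unfolding twist_mult_def
  by (intro degree_sum_le) (auto intro: order.trans[OF degree_monom_le])

lemma coeff_twist_mult_top:
  "coeff (twist_mult f g) (degree f + degree g) = lead_coeff f * frob (degree f) (lead_coeff g)"
proof -
  have "coeff (twist_mult f g) (degree f + degree g)
      = (\<Sum>i\<le>degree f. \<Sum>j\<le>degree g. if j = degree g then (if i = degree f then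
           lead_coeff f * frob (degree f) (lead_coeff g) else 0) else 0)"
    unfolding twist_mult_def coeff_sum by (intro sum.cong refl) auto
  also have "\<dots> = lead_coeff f * frob (degree f) (lead_coeff g)" by (simp add: sum.delta)
  finally show ?thesis .
qed

lemma degree_twist_mult:
  assumes "f \<noteq> 0" "g \<noteq> 0"
  shows "degree (twist_mult f g) = degree f + degree g"
proof (rule antisym[OF degree_twist_mult_le le_degree])
  show "coeff (twist_mult f g) (degree f + degree g) \<noteq> 0"
    unfolding coeff_twist_mult_top using assms by simp
qed

text \<open>
  The \<open>q\<close>-linearized polynomial that has the same values as the twisted polynomial. Kernels of twisted
  polynomials are counted as root sets of such polynomials.
\<close>

definition additive_poly :: "'k :: {field, finite} alg_closure poly \<Rightarrow> 'k alg_closure poly" where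
  "additive_poly f = (\<Sum>i\<le>degree f. monom (coeff f i) (CARD('k) ^ i))"

lemma poly_additive_poly [simp]: "poly (additive_poly f) v = twist_act f v"
  by (simp add: additive_poly_def twist_act_def poly_sum poly_monom frob_def)

lemma coeff_additive_poly:
  "coeff (additive_poly (f :: 'k :: {field, finite} alg_closure poly)) j
     = (\<Sum>i\<le>degree f. if CARD('k) ^ i = j then coeff f i else 0)"
  by (simp add: additive_poly_def coeff_sum)

lemma degree_additive_poly:
  fixes f :: "'k :: {field, finite} alg_closure poly"
  assumes "f \<noteq> 0"
  shows "degree (additive_poly f) = CARD('k) ^ degree f"
proof (rule antisym[OF _ le_degree])
  show "degree (additive_poly f) \<le> CARD('k) ^ degree f"
    unfolding additive_poly_def using card_field_gt_0[where 'k='k]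
    by (intro degree_sum_le) (auto intro!: order.trans[OF degree_monom_le] power_increasing)
  have "coeff (additive_poly f) (CARD('k) ^ degree f)
      = (\<Sum>i\<le>degree f. if i = degree f then lead_coeff f else 0)"
    unfolding coeff_additive_poly using card_field_gt_1[where 'k='k]
    by (intro sum.cong) auto
  then show "coeff (additive_poly f) (CARD('k) ^ degree f) \<noteq> 0" using assms by simp
qed

text \<open>
  All exponents are powers of \<open>q\<close>, which is zero in the field, except for \<open>q^0\<close>.
\<close>

lemma pderiv_additive_poly: "pderiv (additive_poly f) = [:coeff f 0:]"
proof -
  have "pderiv (additive_poly f) = (\<Sum>i\<le>degree f. if i = 0 then [:coeff f 0:] else 0)"
    unfolding additive_poly_def higher_pderiv_sum[of 1, simplified]
  proof (intro sum.cong refl)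
    fix i
    show "pderiv (monom (coeff f i) (CARD('a) ^ i)) = (if i = 0 then [:coeff f 0:] else 0)"
      by (cases i) (simp_all add: pderiv_monom of_nat_card_field monom_0)
  qed
  then show ?thesis by simp
qed

lemma twist_act_kernel_card_le:
  fixes f :: "'k :: {field, finite} alg_closure poly"
  assumes "f \<noteq> 0"
  shows "finite {v. twist_act f v = 0}" "card {v. twist_act f v = 0} \<le> CARD('k) ^ degree f"
proof -
  have "degree (additive_poly f) \<noteq> 0"
    using degree_additive_poly[OF assms] card_field_gt_0[where 'k='k] by simp
  then have nz: "additive_poly f \<noteq> 0" by auto
  from poly_roots_finite[OF nz] show "finite {v. twist_act f v = 0}" by simp
  from card_poly_roots_bound[OF nz] show "card {v. twist_act f v = 0} \<le> CARD('k) ^ degree f"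
    by (simp add: degree_additive_poly[OF assms])
qed

lemma card_roots_separable:
  fixes P :: "'a :: alg_closed_field poly"
  assumes "P \<noteq> 0" "\<And>a. poly P a = 0 \<Longrightarrow> poly (pderiv P) a \<noteq> 0"
  shows "card {a. poly P a = 0} = degree P"
  using assms
proof (induction "degree P" arbitrary: P)
  case 0
  then obtain c where "P = [:c:]" by (metis degree_eq_zeroE)
  with 0 show ?case by simp
next
  case (Suc N)
  then obtain x where x: "poly P x = 0" using alg_closed_imp_poly_has_root[of P] by auto
  then obtain Q where P: "P = [:- x, 1:] * Q" by (metis dvdE poly_eq_0_iff_dvd)
  with Suc.prems have Q: "Q \<noteq> 0" by auto
  have dP: "poly (pderiv P) a = poly Q a + (a - x) * poly (pderiv Q) a" for a
    unfolding P pderiv_mult by (simp add: pderiv_pCons algebra_simps)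
  have "degree P = Suc (degree Q)" unfolding P using Q by (subst degree_mult_eq) auto
  moreover have "poly (pderiv Q) a \<noteq> 0" if "poly Q a = 0" for a
    using Suc.prems(2)[of a] that by (auto simp: dP) (simp add: P)
  ultimately have "card {a. poly Q a = 0} = N" using Suc Q by (metis diff_Suc_1)
  moreover have "poly Q x \<noteq> 0" using Suc.prems(2)[OF x] by (simp add: dP)
  moreover have "{a. poly P a = 0} = insert x {a. poly Q a = 0}" by (auto simp: P)
  ultimately show ?case using poly_roots_finite[OF Q] Suc by simp
qed

text \<open>
  A linearized polynomial with nonzero linear term has a nonzero constant as derivative, so it is separable.
\<close>

lemma twist_act_kernel_card:
  fixes f :: "'k :: {field, finite} alg_closure poly"
  assumes "coeff f 0 \<noteq> 0"
  shows "card {v. twist_act f v = 0} = CARD('k) ^ degree f"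
proof -
  have "f \<noteq> 0" using assms by auto
  moreover have "additive_poly f \<noteq> 0" using pderiv_additive_poly[of f] assms by auto
  ultimately show ?thesis
    using card_roots_separable[of "additive_poly f"] assms
    by (simp add: pderiv_additive_poly degree_additive_poly)
qed

text \<open>
  \<open>Fq_ext i\<close> is the kernel of \<open>\<tau>^i - 1\<close>.
\<close>

lemma card_Fq_ext:
  assumes "i > 0"
  shows "card (Fq_ext i :: 'k :: {field, finite} alg_closure set) = CARD('k) ^ i"
    and "finite (Fq_ext i :: 'k :: {field, finite} alg_closure set)"
proof -
  let ?f = "monom 1 i - 1 :: 'k alg_closure poly"
  have "twist_act ?f v = frob i v - v" for v
  proof -
    have "?f = monom 1 i + [:-1:]" by (simp add: one_pCons)
    then show ?thesis by (simp only: twist_act_add twist_act_monom twist_act_const) simp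
  qed
  then have eq: "Fq_ext i = {v. twist_act ?f v = 0}" by (auto simp: Fq_ext_def)
  have deg: "degree ?f = i"
  proof -
    have "degree (1 :: 'k alg_closure poly) < degree (monom 1 i :: 'k alg_closure poly)"
      using assms by (simp add: degree_monom_eq)
    from degree_add_eq_left[of "-1" "monom 1 i :: 'k alg_closure poly"] this show ?thesis
      by (simp add: degree_monom_eq)
  qed
  have c: "coeff ?f 0 \<noteq> 0" using assms by simp
  then have "?f \<noteq> 0" by (metis coeff_0)
  with deg show "finite (Fq_ext i :: 'k alg_closure set)"
    unfolding eq by (rule_tac twist_act_kernel_card_le)
  show "card (Fq_ext i :: 'k alg_closure set) = CARD('k) ^ i"
    unfolding eq using twist_act_kernel_card[OF c] deg by simp
qed

lemma card_polys_degree_less: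
  assumes "d > 0"
  shows "card {h :: 'k :: {field, finite} poly. degree h < d} = CARD('k) ^ d"
    and "finite {h :: 'k :: {field, finite} poly. degree h < d}"
proof -
  let ?F = "{..<d} \<rightarrow>\<^sub>E (UNIV :: 'k set)"
  have bij: "bij_betw (\<lambda>x. \<Sum>i<d. monom (x i) i) ?F {h. degree h < d}"
  proof (rule bij_betwI[of _ _ _ "\<lambda>h. \<lambda>i\<in>{..<d}. coeff h i"])
    have c: "coeff (\<Sum>i<d. monom (x i) i) j = (if j < d then x j else 0)" for x :: "nat \<Rightarrow> 'k" and j
      by (simp add: coeff_sum)
    show "(\<lambda>x. \<Sum>i<d. monom (x i) i) \<in> ?F \<rightarrow> {h. degree h < d}"
    proof (intro funcsetI CollectI)
      fix x :: "nat \<Rightarrow> 'k"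
      show "degree (\<Sum>i<d. monom (x i) i) < d"
        using assms by (intro degree_lessI) (auto simp: c)
    qed
    show "(\<lambda>i\<in>{..<d}. coeff (\<Sum>i<d. monom (x i) i) i) = x" if "x \<in> ?F" for x
      unfolding c using that by (auto simp: fun_eq_iff PiE_def extensional_def)
    show "(\<Sum>i<d. monom ((\<lambda>i\<in>{..<d}. coeff h i) i) i) = h" if "h \<in> {h. degree h < d}" for h :: "'k poly"
    proof (rule poly_eqI)
      fix j
      show "coeff (\<Sum>i<d. monom ((\<lambda>i\<in>{..<d}. coeff h i) i) i) j = coeff h j"
        unfolding c using that by (cases "j < d") (auto simp: coeff_eq_0)
    qed
  qed auto
  show "card {h :: 'k poly. degree h < d} = CARD('k) ^ d"
    using bij_betw_same_card[OF bij] by (simp add: card_PiE)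
  show "finite {h :: 'k poly. degree h < d}"
    using bij_betw_finite[OF bij] by (simp add: finite_PiE)
qed

section \<open>Polynomials over a field\<close>

text \<open>
  An element of least degree in the ideal generated by \<open>a\<close> and \<open>P\<close> divides both generators, so it is
  a unit when \<open>P\<close> is irreducible and does not divide \<open>a\<close>.
\<close>

lemma irreducible_poly_inverse_mod:
  fixes P a :: "'k :: field poly"
  assumes "irreducible P" "\<not> P dvd a"
  obtains u where "[u * a = 1] (mod P)"
proof -
  let ?I = "{g. g \<noteq> 0 \<and> (\<exists>u v. g = u * a + v * P)}"
  have P: "P \<noteq> 0" using assms(1) by auto
  then have "P \<in> ?I" by (auto intro: exI[of _ 0] exI[of _ 1])
  then obtain g where g: "g \<in> ?I" and min: "\<And>h. h \<in> ?I \<Longrightarrow> degree g \<le> degree h"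
    using ex_has_least_nat[of "\<lambda>g. g \<in> ?I" P degree] by blast
  then obtain u v where uv: "g = u * a + v * P" and g0: "g \<noteq> 0" by blast
  have dvd: "g dvd u' * a + v' * P" for u' v'
  proof (rule ccontr)
    let ?h = "u' * a + v' * P"
    assume "\<not> g dvd ?h"
    then have nz: "?h mod g \<noteq> 0" by (simp add: dvd_eq_mod_eq_0)
    have "?h mod g = ?h - ?h div g * g" by (simp add: minus_div_mult_eq_mod)
    also have "\<dots> = (u' - ?h div g * u) * a + (v' - ?h div g * v) * P"
      unfolding uv by (simp add: algebra_simps)
    finally have "?h mod g \<in> ?I" using nz by blast
    from min[OF this] show False using degree_mod_less[OF g0, of ?h] nz by auto
  qed
  from dvd[of 0 1] have "g dvd P" by simp
  then obtain k where k: "P = g * k" by (elim dvdE)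
  have "is_unit g"
  proof (rule ccontr)
    assume "\<not> is_unit g"
    then have "is_unit k" using assms(1) k by (auto simp: irreducible_def)
    then have "P dvd g" unfolding k by simp
    then have "P dvd a" using dvd[of 1 0] dvd_trans by fastforce
    with assms(2) show False by simp
  qed
  then obtain h where "1 = g * h" by (elim dvdE)
  then have "(h * u) * a - 1 = P * (- h * v)" by (simp add: uv algebra_simps)
  then have "[(h * u) * a = 1] (mod P)" by (metis cong_iff_dvd_diff dvd_triv_left)
  then show ?thesis by (rule that)
qed

lemma poly_eq_prod_roots:
  fixes P :: "'a :: idom poly"
  assumes "lead_coeff P = 1" "finite A" "card A = degree P" "\<And>a. a \<in> A \<Longrightarrow> poly P a = 0"
  shows "P = (\<Prod>a\<in>A. [:- a, 1:])"
proof (rule poly_eqI_degree_lead_coeff[of _ "degree P" _ A])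
  have deg: "degree (\<Prod>a\<in>A. [:- a, 1:]) = degree P"
    using assms(3) by (subst degree_prod_eq_sum_degree) auto
  then show "degree (\<Prod>a\<in>A. [:- a, 1:]) \<le> degree P" by simp
  have "lead_coeff (\<Prod>a\<in>A. [:- a, 1:]) = 1" by (simp add: lead_coeff_prod)
  then show "coeff P (degree P) = coeff (\<Prod>a\<in>A. [:- a, 1:]) (degree P)"
    using assms(1) deg by simp
  show "poly P z = poly (\<Prod>a\<in>A. [:- a, 1:]) z" if "z \<in> A" for z
    using that assms by (auto simp: poly_prod)
qed (use assms in auto)

lemma frob_poly_to_ac: "frob i (poly (map_poly to_ac P) x) = poly (map_poly to_ac P) (frob i x)"
  by (induction P) simp_all

section \<open>The Drinfeld module and its characteristic relation\<close>

text \<open>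
  The data of the theorem except for the bases.
\<close>

locale drinfeld_torsion =
  fixes p0 p :: "'k :: {field, finite} poly" and t :: "'k alg_closure"
    and \<phi> :: "'k poly \<Rightarrow> 'k alg_closure poly" and n r :: nat
  assumes n_pos: "n \<ge> 1"
    and p0_monic: "lead_coeff p0 = 1" and p0_irreducible: "irreducible p0"
    and degree_p0: "degree p0 = r" and gcd_n_r: "gcd n r = 1"
    and t_in: "t \<in> Fq_ext r" and t_root: "poly (map_poly to_ac p0) t = 0"
    and drinfeld: "is_drinfeld_module r n t \<phi>"
    and p_monic: "lead_coeff p = 1" and p_irreducible: "irreducible p" and p_ne_p0: "p \<noteq> p0"
begin

definition phi_T :: "'k alg_closure \<Rightarrow> 'k alg_closure" where
  "phi_T v = t * v + frob n v"

text \<open>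
  The value of \<open>P\<close> at \<open>\<phi>\<^sub>T\<close> with coefficients from the algebraic closure kept on the left. For \<open>P\<close> over
  the ground field this is the action of \<open>\<phi>(P)\<close>. In general \<open>left_eval\<close> is only additive in \<open>P\<close>, because
  \<open>\<phi>\<^sub>T\<close> does not commute with constants.
\<close>

definition left_eval :: "'k alg_closure poly \<Rightarrow> 'k alg_closure \<Rightarrow> 'k alg_closure" where
  "left_eval P v = (\<Sum>i\<le>degree P. coeff P i * (phi_T ^^ i) v)"

abbreviation act :: "'k poly \<Rightarrow> 'k alg_closure \<Rightarrow> 'k alg_closure" where
  "act a v \<equiv> twist_act (\<phi> a) v"

lemma left_eval_bound:
  assumes "degree P \<le> N"
  shows "left_eval P v = (\<Sum>i\<le>N. coeff P i * (phi_T ^^ i) v)"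
  unfolding left_eval_def using assms
  by (intro sum.mono_neutral_left) (auto simp: coeff_eq_0)

lemma left_eval_0 [simp]: "left_eval 0 v = 0"
  by (simp add: left_eval_def)

lemma left_eval_pCons: "left_eval (pCons c P) v = c * v + left_eval P (phi_T v)"
  by (subst left_eval_bound[OF degree_pCons_le], subst sum.atMost_Suc_shift)
    (simp add: left_eval_def funpow_swap1)

lemma left_eval_add: "left_eval (P + Q) v = left_eval P v + left_eval Q v"
proof -
  let ?N = "max (degree P) (degree Q)"
  have "degree (P + Q) \<le> ?N" by (rule degree_add_le_max)
  then show ?thesis
    by (simp add: left_eval_bound[of _ ?N] distrib_right sum.distrib)
qed

lemma left_eval_smult: "left_eval (smult c P) v = c * left_eval P v"
  by (subst left_eval_bound[OF degree_smult_le])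
    (simp add: left_eval_def sum_distrib_left mult.assoc)

lemma left_eval_diff: "left_eval (P - Q) v = left_eval P v - left_eval Q v"
  using left_eval_add[of P "smult (-1) Q" v] left_eval_smult[of "-1" Q v] by simp

lemma left_eval_sum: "left_eval (sum f A) v = (\<Sum>a\<in>A. left_eval (f a) v)"
  by (induction A rule: infinite_finite_induct) (simp_all add: left_eval_add)

lemma phi_hom:
  "\<phi> (a + b) = \<phi> a + \<phi> b" "\<phi> (a * b) = twist_mult (\<phi> a) (\<phi> b)" "\<phi> [:c:] = [:to_ac c:]"
  "\<phi> (monom 1 1) = [:t:] + monom 1 n"
  using drinfeld unfolding is_drinfeld_module_def twisted_alg_hom_def by auto

lemma twist_act_T: "twist_act ([:t:] + monom 1 n) v = phi_T v"
  by (simp only: twist_act_add twist_act_const twist_act_monom phi_T_def mult_1_left)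

lemma degree_T: "degree ([:t:] + monom 1 n) = n" "[:t:] + monom 1 n \<noteq> 0" "coeff ([:t:] + monom 1 n) 0 = t"
proof -
  have "degree [:t:] < degree (monom 1 n :: 'k alg_closure poly)"
    using n_pos by (simp add: degree_monom_eq)
  from degree_add_eq_right[OF this] show "degree ([:t:] + monom 1 n) = n"
    by (simp add: degree_monom_eq)
  then show "[:t:] + monom 1 n \<noteq> 0" using n_pos by auto
  show "coeff ([:t:] + monom 1 n) 0 = t" using n_pos by simp
qed

text \<open>
  The \<open>i\<close>-th power of \<open>t + \<tau>^n\<close> has leading term \<open>\<tau>^(n i)\<close> and constant term \<open>t^i\<close>. Knowing the degree
  and the constant term is enough to count the zeros of \<open>left_eval P\<close>.
\<close>

lemma left_eval_twisted:
  assumes "P \<noteq> 0"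
  shows "\<exists>G. G \<noteq> 0 \<and> degree G = n * degree P \<and> coeff G 0 = poly P t \<and>
    (\<forall>v. twist_act G v = left_eval P v)"
  using assms
proof (induction P)
  case (pCons c P)
  show ?case
  proof (cases "P = 0")
    case True
    then show ?thesis using pCons.hyps by (intro exI[of _ "[:c:]"]) (auto simp: left_eval_pCons)
  next
    case False
    then obtain G where G: "G \<noteq> 0" "degree G = n * degree P" "coeff G 0 = poly P t"
      "\<And>v. twist_act G v = left_eval P v"
      using pCons.IH by blast
    let ?x = "[:t:] + monom 1 n" and ?G = "[:c:] + twist_mult G ([:t:] + monom 1 n)"
    have deg: "degree (twist_mult G ?x) = n * degree P + n"
      using degree_twist_mult[OF G(1) degree_T(2)] degree_T(1) G(2) by simp
    then have "degree ?G = n * degree P + n"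
      using n_pos degree_add_eq_right[of "[:c:]" "twist_mult G ?x"] by simp
    moreover from this have "?G \<noteq> 0" using n_pos by auto
    moreover have "coeff ?G 0 = c + t * poly P t"
      using coeff_twist_mult_0[of G ?x] unfolding degree_T(3) G(3) by (simp add: mult.commute)
    moreover have "twist_act ?G v = left_eval (pCons c P) v" for v
      by (simp only: twist_act_add[of "[:c:]"] twist_act_const twist_act_mult twist_act_T G(4)
          left_eval_pCons)
    ultimately show ?thesis using False by (intro exI[of _ ?G]) simp
  qed
qed simp

lemma act_left_eval: "act a v = left_eval (map_poly to_ac a) v"
proof (induction a arbitrary: v)
  case 0
  show ?case using phi_hom(3)[of 0] by simp
next
  case (pCons c a)
  have "pCons c a = [:c:] + a * monom 1 1" by (simp add: monom_Suc monom_0)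
  then have "\<phi> (pCons c a) = [:to_ac c:] + twist_mult (\<phi> a) ([:t:] + monom 1 n)"
    by (simp only: phi_hom)
  then have "act (pCons c a) v = to_ac c * v + act a (phi_T v)"
    by (simp only: twist_act_add[of "[:to_ac c:]"] twist_act_const twist_act_mult twist_act_T)
  with pCons.IH show ?case by (simp add: left_eval_pCons)
qed

lemma act_add: "act (a + b) v = act a v + act b v"
  by (simp add: phi_hom twist_act_add)

lemma act_0 [simp]: "act 0 v = 0"
  by (simp add: act_left_eval)

lemma act_1 [simp]: "act 1 v = v"
  using phi_hom(3)[of 1] by (simp add: one_pCons)

lemma act_mult: "act (a * b) v = act a (act b v)"
  by (simp add: phi_hom twist_act_mult)

lemma act_commute: "act a (act b v) = act b (act a v)"
  by (metis act_mult mult.commute)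

lemma act_smult: "act (smult c a) v = to_ac c * act a v"
  using act_mult[of "[:c:]" a v] phi_hom(3)[of c] by simp

lemma act_sum: "act (sum f A) v = (\<Sum>i\<in>A. act (f i) v)"
  by (induction A rule: infinite_finite_induct) (simp_all add: act_add)

lemma act_diff: "act (a - b) v = act a v - act b v"
  using act_add[of "a - b" b v] by simp

lemma phi_T_frob: "phi_T (frob r v) = frob r (phi_T v)"
  using t_in by (simp add: phi_T_def Fq_ext_def add.commute)

lemma act_frob: "act a (frob r v) = frob r (act a v)"
proof -
  have "left_eval (map_poly to_ac a) (frob r v) = frob r (left_eval (map_poly to_ac a) v)"
    by (induction a arbitrary: v) (simp_all add: left_eval_pCons phi_T_frob)
  then show ?thesis by (simp add: act_left_eval)
qed

lemma act_frob_mult: "act a (frob (r * i) v) = frob (r * i) (act a v)"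
proof (induction i arbitrary: v)
  case (Suc i)
  have "act a (frob (r * i) (frob r v)) = frob (r * i) (frob r (act a v))"
    unfolding Suc.IH act_frob ..
  then show ?case by (simp add: add.commute)
qed simp

text \<open>
  \<open>\<phi>\<^sub>T\<close> involves only \<open>\<tau>^0\<close> and \<open>\<tau>^n\<close>, and both commute with multiplication by \<open>\<zeta>\<close>.
\<close>

lemma act_scalar:
  assumes "\<zeta> \<in> Fq_ext n"
  shows "act a (\<zeta> * v) = \<zeta> * act a v"
proof -
  have x: "phi_T (\<zeta> * v) = \<zeta> * phi_T v" for v
    using assms by (simp add: phi_T_def Fq_ext_def algebra_simps)
  have "left_eval (map_poly to_ac a) (\<zeta> * v) = \<zeta> * left_eval (map_poly to_ac a) v"
    by (induction a arbitrary: v) (simp_all add: left_eval_pCons x distrib_left mult.left_commute)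
  then show ?thesis by (simp add: act_left_eval)
qed

lemma eval_t_ne_0:
  assumes "\<not> p0 dvd h"
  shows "poly (map_poly to_ac h) t \<noteq> 0"
proof
  assume h: "poly (map_poly to_ac h) t = 0"
  obtain u where "[u * h = 1] (mod p0)"
    using irreducible_poly_inverse_mod[OF p0_irreducible assms] .
  then obtain w where "u * h - 1 = p0 * w" by (auto simp: cong_iff_dvd_diff elim: dvdE)
  then have "u * h = p0 * w + 1" by (simp add: algebra_simps)
  then have "poly (map_poly to_ac (u * h)) t = poly (map_poly to_ac (p0 * w + 1)) t" by simp
  then show False
    using h t_root by (simp add: map_poly_to_ac_mult map_poly_to_ac_add)
qed

lemma r_pos: "r > 0"
proof (rule ccontr)
  assume "\<not> r > 0"
  then have "p0 = 1" using degree_p0 p0_monic by (metis degree_eq_zeroE gr0I lead_coeff_pCons(2) one_pCons)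
  with p0_irreducible show False by simp
qed

lemma not_dvd_of_monic_irreducible:
  assumes "irreducible (P :: 'k poly)" "irreducible Q" "lead_coeff P = 1" "lead_coeff Q = 1" "P \<noteq> Q"
  shows "\<not> P dvd Q"
proof
  assume "P dvd Q"
  then obtain k where k: "Q = P * k" by (elim dvdE)
  have "\<not> is_unit P" using assms(1) by (rule irreducible_not_unit)
  with assms(2) k have "is_unit k" by (auto simp: irreducible_def)
  then obtain c where c: "k = [:c:]" by (metis is_unit_polyE)
  have "lead_coeff Q = lead_coeff P * lead_coeff k" unfolding k by (rule lead_coeff_mult)
  with assms c have "k = 1" by (simp add: one_pCons)
  with k assms show False by simp
qed

lemma p_not_dvd_p0: "\<not> p dvd p0" and p0_not_dvd_p: "\<not> p0 dvd p"
  using not_dvd_of_monic_irreducible p0_irreducible p_irreducible p0_monic p_monic p_ne_p0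
  by metis+

lemma p_nz: "p \<noteq> 0"
  using p_monic by auto

lemma degree_p_pos: "degree p > 0"
proof (rule ccontr)
  assume "\<not> degree p > 0"
  then have "p = 1" using p_monic by (metis degree_eq_zeroE gr0I lead_coeff_pCons(2) one_pCons)
  with p_irreducible show False by simp
qed

text \<open>
  The \<open>q^r\<close> values at \<open>t\<close> of polynomials of degree less than \<open>r\<close> are distinct, and all of them are fixed
  by the \<open>i\<close>-th Frobenius, which has only \<open>q^i\<close> fixed points.
\<close>

lemma frob_t_eq_imp_ge:
  assumes "frob i t = t" "i > 0"
  shows "r \<le> i"
proof -
  let ?H = "{h :: 'k poly. degree h < r}" and ?e = "\<lambda>h. poly (map_poly to_ac h) t"
  have "inj_on ?e ?H"
  proof (rule inj_onI)
    fix h h' assume h: "h \<in> ?H" "h' \<in> ?H" "?e h = ?e h'"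
    have "?e h = ?e (h - h') + ?e h'"
      unfolding poly_add[symmetric] map_poly_to_ac_add[symmetric] by simp
    with h have "p0 dvd h - h'" using eval_t_ne_0[of "h - h'"] by auto
    moreover have "degree (h - h') < degree p0"
      using h degree_p0 by (auto intro: le_less_trans[OF degree_diff_le_max])
    ultimately have "h - h' = 0" by (metis dvd_imp_degree_le not_less)
    then show "h = h'" by simp
  qed
  moreover have "?e ` ?H \<subseteq> Fq_ext i"
    using assms(1) by (auto simp: Fq_ext_def frob_poly_to_ac)
  ultimately have "card ?H \<le> card (Fq_ext i :: 'k alg_closure set)"
    using card_Fq_ext(2)[OF assms(2)] by (intro card_inj_on_le)
  then have "CARD('k) ^ r \<le> CARD('k) ^ i"
    using card_polys_degree_less(1)[OF r_pos, where 'k='k] card_Fq_ext(1)[OF assms(2), where 'k='k]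
    by simp
  then show ?thesis using card_field_gt_1[where 'k='k] by (simp add: power_le_imp_le_exp)
qed

lemma frob_t_eq_iff: "frob i t = t \<longleftrightarrow> r dvd i"
proof
  assume "frob i t = t"
  then have "frob (i mod r) t = t" using frob_mod[OF t_in] by simp
  then have "i mod r = 0" using frob_t_eq_imp_ge[of "i mod r"] r_pos mod_less_divisor[of r i]
    by (metis gr0I not_less)
  then show "r dvd i" by auto
qed (use Fq_ext_mult_index[OF t_in] in \<open>auto elim!: dvdE\<close>)

lemma inj_on_conjugates: "inj_on (\<lambda>j. frob (n * j) t) {..<r}"
proof -
  have *: "i = j" if "i \<le> j" "j < r" "frob (n * i) t = frob (n * j) t" for i j
  proof -
    have "n * j = n * i + n * (j - i)" using that(1) by (simp flip: add_mult_distrib2)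
    then have "frob (n * i) (frob (n * (j - i)) t) = frob (n * i) t"
      using that(3) by simp
    then have "frob (n * (j - i)) t = t" using inj_frob by (metis injD)
    then have "r dvd n * (j - i)" by (simp add: frob_t_eq_iff)
    then have "r dvd j - i" using gcd_n_r
      by (metis coprime_dvd_mult_right_iff coprime_iff_gcd_eq_1 gcd.commute)
    then show ?thesis using that by (metis diff_is_0_eq dvd_imp_le le_antisym less_imp_diff_less not_less gr0I)
  qed
  show ?thesis
    by (rule inj_onI) (metis "*" lessThan_iff nle_le)
qed

lemma p0_factorization: "map_poly to_ac p0 = (\<Prod>j<r. [:- frob (n * j) t, 1:])"
proof -
  let ?c = "\<lambda>j. frob (n * j) t"
  have deg: "degree (map_poly to_ac p0) = r" using degree_p0 by (simp add: degree_map_poly)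
  have "map_poly to_ac p0 = (\<Prod>a\<in>?c ` {..<r}. [:- a, 1:])"
  proof (rule poly_eq_prod_roots)
    show "lead_coeff (map_poly to_ac p0) = 1" using p0_monic deg degree_p0 by (simp add: coeff_map_poly)
    show "card (?c ` {..<r}) = degree (map_poly to_ac p0)"
      using inj_on_conjugates deg by (simp add: card_image)
    show "poly (map_poly to_ac p0) a = 0" if "a \<in> ?c ` {..<r}" for a
      using that t_root by (auto simp flip: frob_poly_to_ac)
  qed simp
  also have "\<dots> = (\<Prod>j<r. [:- ?c j, 1:])"
    using inj_on_conjugates by (simp add: prod.reindex)
  finally show ?thesis .
qed

lemma left_eval_mult_linear:
  "left_eval (P * [:- s, 1:]) v = left_eval P (phi_T v) - s * left_eval P v"
proof -
  have "P * [:- s, 1:] = pCons 0 P - smult s P" by simp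
  then show ?thesis by (simp only: left_eval_diff left_eval_smult left_eval_pCons) simp
qed

text \<open>
  As operators, \<open>\<tau>^(n i) \<phi>\<^sub>T = t^(q^(n i)) \<tau>^(n i) + \<tau>^(n (i+1))\<close>. The next linear factor cancels the first
  summand.
\<close>

lemma left_eval_partial_product:
  "left_eval (\<Prod>j<i. [:- frob (n * j) t, 1:]) v = frob (n * i) v"
proof (induction i arbitrary: v)
  case 0
  then show ?case using left_eval_pCons[of 1 0 v] by (simp add: one_pCons)
next
  case (Suc i)
  have "frob (n * i) (phi_T v) = frob (n * i) t * frob (n * i) v + frob (n * Suc i) v"
    by (simp add: phi_T_def add.commute)
  then show ?case unfolding prod.lessThan_Suc left_eval_mult_linear Suc.IH by simp
qed

text \<open>
  The full product over the roots of \<open>p0\<close> telescopes to \<open>\<tau>^(n r)\<close>. On \<open>M\<close> this says \<open>\<pi>^n = c\<close>.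
\<close>

lemma act_p0: "act p0 v = frob (r * n) v"
  unfolding act_left_eval p0_factorization left_eval_partial_product by (simp add: mult.commute)

section \<open>The torsion module\<close>

abbreviation M :: "'k alg_closure set" where "M \<equiv> torsion \<phi> p"
abbreviation d :: nat where "d \<equiv> degree p"

lemma M_iff: "v \<in> M \<longleftrightarrow> act p v = 0"
  by (simp add: torsion_def)

lemma act_in_M: "v \<in> M \<Longrightarrow> act a v \<in> M"
  by (simp add: M_iff mult.commute flip: act_mult) (simp add: act_mult)

lemma zero_in_M [simp]: "0 \<in> M"
  and add_in_M: "v \<in> M \<Longrightarrow> w \<in> M \<Longrightarrow> v + w \<in> M"
  and minus_in_M: "v \<in> M \<Longrightarrow> - v \<in> M"
  by (simp_all add: M_iff twist_act_plus twist_act_minus)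

lemma sum_in_M: "(\<And>i. i \<in> A \<Longrightarrow> g i \<in> M) \<Longrightarrow> sum g A \<in> M"
  by (induction A rule: infinite_finite_induct) (simp_all add: add_in_M)

lemma scalar_in_M: "\<zeta> \<in> Fq_ext n \<Longrightarrow> v \<in> M \<Longrightarrow> \<zeta> * v \<in> M"
  by (simp add: M_iff act_scalar)

lemma frob_in_M: "v \<in> M \<Longrightarrow> frob (r * i) v \<in> M"
  by (simp add: M_iff act_frob_mult)

lemma act_cong:
  assumes "[a = b] (mod p)" "v \<in> M"
  shows "act a v = act b v"
proof -
  obtain w where "a - b = p * w" using assms(1) by (auto simp: cong_iff_dvd_diff elim: dvdE)
  then have "a = b + w * p" by (simp add: algebra_simps)
  then show ?thesis using assms(2) by (simp add: act_add act_mult M_iff)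
qed

text \<open>
  The constant term of \<open>\<phi>(p)\<close> is \<open>p(t)\<close>. It is nonzero because \<open>p\<close> is not the minimal polynomial of \<open>t\<close>,
  so \<open>\<phi>(p)\<close> is separable.
\<close>

lemma card_M: "card M = CARD('k) ^ (n * d)" and finite_M: "finite M"
proof -
  have nz: "map_poly to_ac p \<noteq> 0" using p_nz by (simp add: map_poly_eq_0_iff)
  have deg: "degree (map_poly to_ac p) = d" by (simp add: degree_map_poly)
  obtain G where G: "G \<noteq> 0" "degree G = n * d" "coeff G 0 = poly (map_poly to_ac p) t"
    "\<And>v. twist_act G v = left_eval (map_poly to_ac p) v"
    using left_eval_twisted[OF nz] deg by auto
  have M: "M = {v. twist_act G v = 0}" by (simp add: torsion_def act_left_eval G(4))
  have "coeff G 0 \<noteq> 0" using G(3) eval_t_ne_0[OF p0_not_dvd_p] by simp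
  from twist_act_kernel_card[OF this] show "card M = CARD('k) ^ (n * d)" by (simp add: M G(2))
  show "finite M" unfolding M by (rule twist_act_kernel_card_le(1)[OF G(1)])
qed

text \<open>
  Otherwise a twisted polynomial of \<open>\<tau>\<close>-degree less than \<open>n d\<close> would have \<open>q^(n d)\<close> zeros.
\<close>

lemma left_eval_eq_0_on_M:
  assumes "degree P < d" "\<And>v. v \<in> M \<Longrightarrow> left_eval P v = 0"
  shows "P = 0"
proof (rule ccontr)
  assume "P \<noteq> 0"
  then obtain G where G: "G \<noteq> 0" "degree G = n * degree P" "\<And>v. twist_act G v = left_eval P v"
    using left_eval_twisted by blast
  have "card M \<le> card {v. twist_act G v = 0}"
    using twist_act_kernel_card_le(1)[OF G(1)] assms(2) G(3) by (intro card_mono) auto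
  also have "\<dots> \<le> CARD('k) ^ (n * degree P)"
    using twist_act_kernel_card_le(2)[OF G(1)] G(2) by simp
  also have "\<dots> < CARD('k) ^ (n * d)"
    using assms(1) n_pos card_field_gt_1[where 'k='k] by (intro power_strict_increasing) auto
  finally show False by (simp add: card_M)
qed

lemma frob_image_M: "(\<lambda>v. frob (r * i) v) ` M = M"
proof (rule endo_inj_surj[OF finite_M])
  show "(\<lambda>v. frob (r * i) v) ` M \<subseteq> M" using frob_in_M by auto
  show "inj_on (\<lambda>v. frob (r * i) v) M" using inj_frob by (metis inj_on_subset subset_UNIV)
qed


section \<open>The endomorphism ring and its size\<close>

abbreviation E where "E \<equiv> End_tors \<phi> p"

lemma E_carrier_iff:
  "f \<in> carrier E \<longleftrightarrow> f \<in> M \<rightarrow>\<^sub>E M \<and> (\<forall>v\<in>M. \<forall>w\<in>M. f (v + w) = f v + f w) \<and>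
     (\<forall>a. \<forall>v\<in>M. f (act a v) = act a (f v))"
  by (simp add: End_tors_def)

lemma E_in_M: "f \<in> carrier E \<Longrightarrow> v \<in> M \<Longrightarrow> f v \<in> M"
  and E_add: "f \<in> carrier E \<Longrightarrow> v \<in> M \<Longrightarrow> w \<in> M \<Longrightarrow> f (v + w) = f v + f w"
  and E_act: "f \<in> carrier E \<Longrightarrow> v \<in> M \<Longrightarrow> f (act a v) = act a (f v)"
  by (auto simp: E_carrier_iff)

lemma E_restrictI:
  assumes "\<And>v. v \<in> M \<Longrightarrow> f v \<in> M" "\<And>v w. v \<in> M \<Longrightarrow> w \<in> M \<Longrightarrow> f (v + w) = f v + f w"
    "\<And>a v. v \<in> M \<Longrightarrow> f (act a v) = act a (f v)"
  shows "restrict f M \<in> carrier E"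
  using assms by (auto simp: E_carrier_iff add_in_M act_in_M)

lemma E_eqI:
  assumes "f \<in> carrier E" "g \<in> carrier E" "\<And>v. v \<in> M \<Longrightarrow> f v = g v"
  shows "f = g"
  using assms by (intro extensionalityI[of f M g]) (auto simp: E_carrier_iff PiE_def)

lemma E_zero: "f \<in> carrier E \<Longrightarrow> f 0 = 0"
  using E_add[of f 0 0] by (metis add_0 add_right_cancel zero_in_M)

lemma E_sum:
  assumes "f \<in> carrier E" "\<And>i. i \<in> A \<Longrightarrow> g i \<in> M"
  shows "f (sum g A) = (\<Sum>i\<in>A. f (g i))"
  using assms(2)
  by (induction A rule: infinite_finite_induct)
    (simp_all add: E_zero[OF assms(1)] E_add[OF assms(1)] sum_in_M)

lemma E_mult_apply [simp]: "v \<in> M \<Longrightarrow> (f \<otimes>\<^bsub>E\<^esub> g) v = f (g v)"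
  and E_add_apply [simp]: "v \<in> M \<Longrightarrow> (f \<oplus>\<^bsub>E\<^esub> g) v = f v + g v"
  and E_one_apply [simp]: "v \<in> M \<Longrightarrow> \<one>\<^bsub>E\<^esub> v = v"
  and E_zero_apply [simp]: "v \<in> M \<Longrightarrow> \<zero>\<^bsub>E\<^esub> v = 0"
  by (simp_all add: End_tors_def compose_def)

lemma E_mult_closed:
  assumes "f \<in> carrier E" "g \<in> carrier E"
  shows "f \<otimes>\<^bsub>E\<^esub> g \<in> carrier E"
proof -
  have "f \<otimes>\<^bsub>E\<^esub> g = (\<lambda>v\<in>M. f (g v))" by (simp add: End_tors_def compose_def)
  also have "\<dots> \<in> carrier E"
    by (rule E_restrictI) (simp_all add: assms E_in_M E_add E_act)
  finally show ?thesis .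
qed

lemma E_add_closed: "f \<in> carrier E \<Longrightarrow> g \<in> carrier E \<Longrightarrow> f \<oplus>\<^bsub>E\<^esub> g \<in> carrier E"
  by (auto simp: End_tors_def Pi_iff twist_act_plus intro!: add_in_M act_in_M)

lemma E_one_closed: "\<one>\<^bsub>E\<^esub> \<in> carrier E" and E_zero_closed: "\<zero>\<^bsub>E\<^esub> \<in> carrier E"
  by (auto simp: End_tors_def intro!: add_in_M act_in_M)

lemma ring_E: "ring E"
proof (rule ringI)
  show "abelian_group E"
  proof (rule abelian_groupI)
    fix f assume f: "f \<in> carrier E"
    let ?g = "\<lambda>v\<in>M. - f v"
    have g: "?g \<in> carrier E"
      by (rule E_restrictI) (simp_all add: E_in_M[OF f] E_add[OF f] E_act[OF f] minus_in_M twist_act_minus)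
    then have "?g \<oplus>\<^bsub>E\<^esub> f = \<zero>\<^bsub>E\<^esub>"
      by (intro E_eqI E_add_closed E_zero_closed f) simp_all
    with g show "\<exists>g\<in>carrier E. g \<oplus>\<^bsub>E\<^esub> f = \<zero>\<^bsub>E\<^esub>" by blast
  qed (auto intro!: E_add_closed E_zero_closed E_eqI)
  show "monoid E"
    by (rule monoidI) (auto intro!: E_mult_closed E_one_closed E_eqI simp: E_in_M)
qed (auto intro!: E_mult_closed E_add_closed E_eqI simp: E_in_M E_add)

lemma kappa_act_closed: "kappa_act \<phi> p a \<in> carrier E"
  unfolding kappa_act_def
  by (rule E_restrictI) (simp_all add: act_in_M twist_act_plus mult.commute flip: act_mult)

lemma L_act_closed: "\<zeta> \<in> Fq_ext n \<Longrightarrow> L_act \<phi> p \<zeta> \<in> carrier E"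
  unfolding L_act_def
  by (rule E_restrictI) (simp_all add: scalar_in_M distrib_left act_scalar)

lemma frob_end_closed: "frob_end \<phi> p (r * i) \<in> carrier E"
  unfolding frob_end_def
  by (rule E_restrictI) (simp_all add: frob_in_M act_frob_mult)

lemma frob_end_power: "frob_end \<phi> p r [^]\<^bsub>E\<^esub> i = frob_end \<phi> p (r * i)"
proof (induction i)
  case 0
  show ?case by (simp add: End_tors_def frob_end_def nat_pow_def)
next
  case (Suc i)
  have "frob_end \<phi> p r [^]\<^bsub>E\<^esub> Suc i = frob_end \<phi> p (r * i) \<otimes>\<^bsub>E\<^esub> frob_end \<phi> p r"
    using Suc.IH by (simp add: nat_pow_def)
  also have "\<dots> = frob_end \<phi> p (r * Suc i)"
    using frob_in_M[of _ 1]
    by (intro E_eqI E_mult_closed frob_end_closed frob_end_closed[of 1, simplified])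
      (simp_all add: frob_end_def add.commute)
  finally show ?case .
qed

lemma finsum_E_apply:
  assumes "finite A" "\<And>i. i \<in> A \<Longrightarrow> F i \<in> carrier E" "v \<in> M"
  shows "finsum E F A v = (\<Sum>i\<in>A. F i v)"
proof -
  interpret ring E by (rule ring_E)
  from assms(1,2) show ?thesis
    by (induction A rule: finite_induct) (simp_all add: assms(3) Pi_iff)
qed

definition kappa_comb :: "'k alg_closure set \<Rightarrow> ('k alg_closure \<Rightarrow> 'k poly) \<Rightarrow> 'k alg_closure" where
  "kappa_comb G a = (\<Sum>g\<in>G. act (a g) g)"

text \<open>
  Linear independence over \<open>\<kappa>\<close>, with scalars given by their representatives of degree less than \<open>d\<close>.
\<close>

definition kappa_independent :: "'k alg_closure set \<Rightarrow> bool" where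
  "kappa_independent G \<longleftrightarrow> inj_on (kappa_comb G) (G \<rightarrow>\<^sub>E {a. degree a < d})"

lemma kappa_independent_card_le:
  assumes "G \<subseteq> M" "kappa_independent G"
  shows "card G \<le> n"
proof -
  let ?A = "{a :: 'k poly. degree a < d}"
  have fin: "finite G" using assms(1) finite_M by (rule finite_subset)
  have "kappa_comb G ` (G \<rightarrow>\<^sub>E ?A) \<subseteq> M"
    using assms(1) by (auto simp: kappa_comb_def intro!: sum_in_M act_in_M)
  then have "card (G \<rightarrow>\<^sub>E ?A) \<le> card M"
    using assms(2) finite_M unfolding kappa_independent_def by (intro card_inj_on_le)
  then have "(CARD('k) ^ d) ^ card G \<le> CARD('k) ^ (n * d)"
    using fin by (simp add: card_PiE card_M card_polys_degree_less(1)[OF degree_p_pos])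
  then have "CARD('k) ^ (d * card G) \<le> CARD('k) ^ (d * n)"
    by (simp add: power_mult mult.commute flip: power_mult)
  then show ?thesis using degree_p_pos card_field_gt_1[where 'k='k] by (simp add: power_le_imp_le_exp)
qed

text \<open>
  A maximal independent set generates. In a dependence relation involving a further element, the
  coefficient of that element is nonzero, hence invertible modulo \<open>p\<close>.
\<close>

lemma exists_generators:
  obtains G where "G \<subseteq> M" "card G \<le> n" "\<And>v. v \<in> M \<Longrightarrow> \<exists>a. v = kappa_comb G a"
proof -
  let ?ind = "\<lambda>G. G \<subseteq> M \<and> kappa_independent G" and ?A = "{a :: 'k poly. degree a < d}"
  have "?ind {}" by (simp add: kappa_independent_def)
  moreover have "\<forall>G. ?ind G \<longrightarrow> card G < Suc n" using kappa_independent_card_le by (simp add: less_Suc_eq_le)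
  ultimately obtain G where G: "?ind G" and max: "\<forall>G'. ?ind G' \<longrightarrow> card G' \<le> card G"
    using ex_has_greatest_nat[of ?ind "{}" card "Suc n"] by metis
  have fin: "finite G" using G finite_M by (meson finite_subset)
  have "\<exists>a. v = kappa_comb G a" if v: "v \<in> M" for v
  proof (cases "v \<in> G")
    case True
    have "kappa_comb G (\<lambda>g. if g = v then 1 else 0) = (\<Sum>g\<in>G. if g = v then v else 0)"
      unfolding kappa_comb_def by (intro sum.cong) auto
    then show ?thesis using True fin by (intro exI[of _ "\<lambda>g. if g = v then 1 else 0"]) simp
  next
    case False
    then have "\<not> ?ind (insert v G)" using max fin by (auto dest!: spec[of _ "insert v G"])
    then have "\<not> kappa_independent (insert v G)" using G v by auto
    then obtain a b where ab: "a \<in> insert v G \<rightarrow>\<^sub>E ?A" "b \<in> insert v G \<rightarrow>\<^sub>E ?A" "a \<noteq> b"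
      "kappa_comb (insert v G) a = kappa_comb (insert v G) b"
      unfolding kappa_independent_def inj_on_def by blast
    define c where "c = a v - b v"
    have rel: "act c v = kappa_comb G (\<lambda>g. b g - a g)"
      using ab(4) False fin
      by (simp add: kappa_comb_def c_def act_diff sum_subtractf) (simp add: algebra_simps)
    have "c \<noteq> 0"
    proof
      assume "c = 0"
      then have v: "a v = b v" by (simp add: c_def)
      have "kappa_comb G (restrict a G) = kappa_comb G (restrict b G)"
        using rel \<open>c = 0\<close> by (simp add: kappa_comb_def act_diff sum_subtractf)
      moreover have "restrict a G \<in> G \<rightarrow>\<^sub>E ?A" "restrict b G \<in> G \<rightarrow>\<^sub>E ?A" using ab(1,2) by auto
      ultimately have "restrict a G = restrict b G"
        using G unfolding kappa_independent_def inj_on_def by blast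
      then have "a g = b g" if "g \<in> insert v G" for g
        using that v by (auto simp: restrict_def fun_eq_iff split: if_splits)
      then have "a = b" using ab(1,2) by (intro PiE_ext)
      with ab(3) show False ..
    qed
    moreover have "degree c < d"
      using ab(1,2) unfolding c_def by (intro le_less_trans[OF degree_diff_le_max]) (auto simp: PiE_iff)
    ultimately have "\<not> p dvd c" using dvd_imp_degree_le[of p c] by auto
    then obtain u where "[u * c = 1] (mod p)"
      using irreducible_poly_inverse_mod[OF p_irreducible] by blast
    then have "act (u * c) v = act 1 v" using v by (rule act_cong)
    then have "v = act u (act c v)" by (simp only: act_mult act_1)
    also have "\<dots> = kappa_comb G (\<lambda>g. u * (b g - a g))"
      unfolding rel by (simp add: kappa_comb_def twist_act_sum_right act_mult)
    finally show ?thesis by blast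
  qed
  with G kappa_independent_card_le that show ?thesis by blast
qed

text \<open>
  An endomorphism is determined by its values on a set of generators.
\<close>

lemma card_E_le: "card (carrier E) \<le> CARD('k) ^ (n * d * n)" and finite_E: "finite (carrier E)"
proof -
  obtain G where G: "G \<subseteq> M" "card G \<le> n" "\<And>v. v \<in> M \<Longrightarrow> \<exists>a. v = kappa_comb G a"
    using exists_generators by blast
  have fin: "finite G" using G(1) finite_M by (rule finite_subset)
  have f: "f (kappa_comb G a) = (\<Sum>g\<in>G. act (a g) (f g))" if "f \<in> carrier E" for f a
    using G(1) unfolding kappa_comb_def
    by (subst E_sum[OF that]) (auto intro!: sum.cong act_in_M E_act[OF that])
  have inj: "inj_on (\<lambda>f. restrict f G) (carrier E)"
  proof (rule inj_onI)
    fix f h assume fh: "f \<in> carrier E" "h \<in> carrier E" "restrict f G = restrict h G"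
    then have eq: "f g = h g" if "g \<in> G" for g using that by (metis restrict_apply')
    show "f = h"
    proof (rule E_eqI[OF fh(1,2)])
      fix v assume "v \<in> M"
      then obtain a where "v = kappa_comb G a" using G(3) by blast
      then show "f v = h v" using eq by (simp add: f fh(1,2))
    qed
  qed
  have sub: "(\<lambda>f. restrict f G) ` carrier E \<subseteq> G \<rightarrow>\<^sub>E M"
    using G(1) E_in_M by (auto simp: subset_iff)
  have finP: "finite (G \<rightarrow>\<^sub>E M)" using fin finite_M by (intro finite_PiE) auto
  from inj sub finP show "finite (carrier E)" by (rule inj_on_finite)
  have "card (carrier E) \<le> card (G \<rightarrow>\<^sub>E M)" using inj sub finP by (rule card_inj_on_le)
  also have "\<dots> = CARD('k) ^ (n * d * card G)" using fin by (simp add: card_PiE card_M flip: power_mult)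
  also have "\<dots> \<le> CARD('k) ^ (n * d * n)"
    using G(2) card_field_gt_0[where 'k='k] by (intro power_increasing) auto
  finally show "card (carrier E) \<le> CARD('k) ^ (n * d * n)" .
qed

end

section \<open>Coordinates in the residue field and in the scalar field\<close>

locale drinfeld_bases = drinfeld_torsion p0 p t \<phi> n r
  for p0 p :: "'k :: {field, finite} poly" and t :: "'k alg_closure"
    and \<phi> :: "'k poly \<Rightarrow> 'k alg_closure poly" and n r :: nat +
  fixes m :: nat and \<theta> :: "'k alg_closure" and \<epsilon> :: "'k poly"
  assumes m_dvd_n: "m dvd n" and \<theta>_normal: "normal_in_ext m \<theta>" and \<epsilon>_normal: "normal_mod p \<epsilon>"
begin

definition eps :: "nat \<Rightarrow> 'k poly" where
  "eps l = \<epsilon> ^ (CARD('k) ^ l)"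

lemma kappa_coords_spec:
  "kappa_coords p \<epsilon> a \<in> carrier_vec d"
  "[a = (\<Sum>l<d. smult (kappa_coords p \<epsilon> a $ l) (eps l))] (mod p)"
proof -
  have "\<exists>!x. x \<in> carrier_vec d \<and> [a = (\<Sum>l<d. smult (x $ l) (eps l))] (mod p)"
    using \<epsilon>_normal unfolding normal_mod_def eps_def by blast
  from theI'[OF this] show "kappa_coords p \<epsilon> a \<in> carrier_vec d"
    "[a = (\<Sum>l<d. smult (kappa_coords p \<epsilon> a $ l) (eps l))] (mod p)"
    unfolding kappa_coords_def eps_def by auto
qed

lemma kappa_coords_unique:
  assumes "[a = (\<Sum>l<d. smult (x l) (eps l))] (mod p)" "l < d"
  shows "kappa_coords p \<epsilon> a $ l = x l"
proof -
  have ex: "\<exists>!x. x \<in> carrier_vec d \<and> [a = (\<Sum>l<d. smult (x $ l) (eps l))] (mod p)"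
    using \<epsilon>_normal unfolding normal_mod_def eps_def by blast
  have "vec d x \<in> carrier_vec d \<and> [a = (\<Sum>l<d. smult (vec d x $ l) (eps l))] (mod p)"
    using assms(1) by simp
  then have "kappa_coords p \<epsilon> a = vec d x"
    using ex kappa_coords_spec[of a] by blast
  then show ?thesis using assms(2) by simp
qed

lemma smult_sum_right: "smult c (sum f A) = (\<Sum>i\<in>A. smult c (f i))"
  by (induction A rule: infinite_finite_induct) (simp_all add: smult_add_right)

lemma kappa_coords_lin:
  assumes "[a = (\<Sum>i\<in>I. smult (y i) (z i))] (mod p)" "l < d"
  shows "kappa_coords p \<epsilon> a $ l = (\<Sum>i\<in>I. y i * kappa_coords p \<epsilon> (z i) $ l)"
proof (rule kappa_coords_unique[OF _ assms(2)])
  let ?K = "\<lambda>i l. kappa_coords p \<epsilon> (z i) $ l"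
  note assms(1)
  also have "[(\<Sum>i\<in>I. smult (y i) (z i)) = (\<Sum>i\<in>I. smult (y i) (\<Sum>l<d. smult (?K i l) (eps l)))] (mod p)"
  proof (rule cong_sum)
    fix i
    show "[smult (y i) (z i) = smult (y i) (\<Sum>l<d. smult (?K i l) (eps l))] (mod p)"
      using cong_scalar_left[OF kappa_coords_spec(2)[of "z i"], of "[:y i:]"] by simp
  qed
  also have "(\<Sum>i\<in>I. smult (y i) (\<Sum>l<d. smult (?K i l) (eps l)))
      = (\<Sum>l<d. \<Sum>i\<in>I. smult (y i * ?K i l) (eps l))"
    by (subst sum.swap) (simp add: smult_sum_right)
  also have "\<dots> = (\<Sum>l<d. smult (\<Sum>i\<in>I. y i * ?K i l) (eps l))"
    by (simp add: smult_sum)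
  finally show "[a = (\<Sum>l<d. smult (\<Sum>i\<in>I. y i * ?K i l) (eps l))] (mod p)" .
qed

lemma kappa_coords_eps:
  assumes "l < d" "l' < d"
  shows "kappa_coords p \<epsilon> (eps l) $ l' = (if l = l' then 1 else 0)"
proof (rule kappa_coords_unique[OF _ assms(2)])
  have "(\<Sum>l'<d. smult (if l = l' then 1 else 0) (eps l')) = (\<Sum>l'<d. if l = l' then eps l' else 0)"
    by (intro sum.cong) auto
  then show "[eps l = (\<Sum>l'<d. smult (if l = l' then 1 else 0) (eps l'))] (mod p)"
    using assms(1) by simp
qed

lemma kappa_coords_cong:
  assumes "[a = b] (mod p)" "l < d"
  shows "kappa_coords p \<epsilon> a $ l = kappa_coords p \<epsilon> b $ l"
  using kappa_coords_unique[OF cong_trans[OF assms(1) kappa_coords_spec(2)] assms(2)] .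

text \<open>
  Multiplications by \<open>a\<close> and \<open>b\<close> are inverse to each other on \<open>\<kappa>\<close>, hence so are their matrices.
\<close>

lemma kappa_coords_matrix_mult:
  assumes "[a * b = 1] (mod p)" "l < d" "l'' < d"
  shows "(\<Sum>l'<d. kappa_coords p \<epsilon> (a * eps l) $ l' * kappa_coords p \<epsilon> (b * eps l') $ l'')
    = (if l = l'' then 1 else 0)"
proof -
  let ?K = "\<lambda>l'. kappa_coords p \<epsilon> (a * eps l) $ l'"
  have "[b * (a * eps l) = b * (\<Sum>l'<d. smult (?K l') (eps l'))] (mod p)"
    by (intro cong_scalar_left kappa_coords_spec)
  then have *: "[b * (a * eps l) = (\<Sum>l'<d. smult (?K l') (b * eps l'))] (mod p)"
    by (simp add: sum_distrib_left)
  have "[b * (a * eps l) = eps l] (mod p)"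
    using cong_scalar_right[OF assms(1), of "eps l"] by (simp add: mult_ac)
  from kappa_coords_cong[OF this assms(3)] show ?thesis
    using kappa_coords_lin[OF * assms(3)] kappa_coords_eps[OF assms(2,3)] by simp
qed

text \<open>
  Independence of the \<open>\<epsilon>\<^sub>l\<close> over the ground field survives the extension of scalars: the change of basis
  to \<open>1, X, \<dots>, X^(d-1)\<close> is given by a matrix over the ground field, and its inverse still works over the
  extension.
\<close>

lemma eps_independent:
  assumes "(\<Sum>l<d. smult (c l) (map_poly to_ac (eps l mod p))) = 0" "l < d"
  shows "c l = 0"
proof -
  let ?e = "\<lambda>l j. coeff (eps l mod p) j" and ?K = "\<lambda>j. kappa_coords p \<epsilon> (monom 1 j) $ l"
  have zero: "(\<Sum>l'<d. c l' * to_ac (?e l' j)) = 0" for j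
  proof -
    have "coeff (\<Sum>l'<d. smult (c l') (map_poly to_ac (eps l' mod p))) j = 0" using assms(1) by simp
    then show ?thesis by (simp add: coeff_sum coeff_map_poly)
  qed
  \<comment> \<open>The monomial coefficients of the \<open>\<epsilon>\<^sub>l\<close> and the coordinates of the monomials are inverse matrices.\<close>
  have unit: "(\<Sum>j<d. ?e l' j * ?K j) = (if l' = l then 1 else 0)" if l': "l' < d" for l'
  proof -
    have "degree (eps l' mod p) < d"
      using degree_mod_less'[of p "eps l'"] p_nz degree_p_pos by (cases "eps l' mod p = 0") auto
    then have "(\<Sum>j<d. smult (?e l' j) (monom 1 j)) = eps l' mod p"
      by (auto simp: poly_eq_iff coeff_sum smult_monom coeff_eq_0)
    then have "[eps l' = (\<Sum>j<d. smult (?e l' j) (monom 1 j))] (mod p)"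
      by (simp add: cong_def)
    from kappa_coords_lin[OF this assms(2)] show ?thesis
      using kappa_coords_eps[OF l' assms(2)] by simp
  qed
  have "c l = (\<Sum>l'<d. c l' * to_ac (if l' = l then 1 else 0))"
    using assms(2) by (simp add: if_distrib cong: if_cong)
  also have "\<dots> = (\<Sum>l'<d. c l' * to_ac (\<Sum>j<d. ?e l' j * ?K j))"
    using unit by (intro sum.cong) auto
  also have "\<dots> = (\<Sum>j<d. \<Sum>l'<d. c l' * to_ac (?e l' j) * to_ac (?K j))"
    by (subst sum.swap) (simp add: to_ac_sum sum_distrib_left mult.assoc)
  also have "\<dots> = (\<Sum>j<d. (\<Sum>l'<d. c l' * to_ac (?e l' j)) * to_ac (?K j))"
    by (simp add: sum_distrib_right)
  also have "\<dots> = 0" by (simp only: zero) simp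
  finally show ?thesis .
qed

lemma m_pos: "m > 0"
  using m_dvd_n n_pos by (auto intro: Nat.gr0I)

lemma coprime_r_n: "coprime r n"
  using gcd_n_r by (simp add: coprime_iff_gcd_eq_1 gcd.commute)

lemma coprime_r_m: "coprime r m"
  using coprime_r_n m_dvd_n by (metis coprime_divisors dvd_refl)

lemma bij_betw_mult_mod:
  assumes "coprime (r::nat) N" "N > 0"
  shows "bij_betw (\<lambda>i. r * i mod N) {..<N} {..<N}"
proof -
  have "inj_on (\<lambda>i. r * i mod N) {..<N}"
  proof (rule inj_onI)
    fix i j assume ij: "i \<in> {..<N}" "j \<in> {..<N}" "r * i mod N = r * j mod N"
    then have "[i = j] (mod N)" using cong_mult_lcancel_nat[OF assms(1)] by (simp add: cong_def)
    then show "i = j" using ij by (simp add: cong_def)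
  qed
  then show ?thesis using assms(2) by (intro bij_betw_imageI endo_inj_surj) auto
qed

lemma \<theta>_in: "\<theta> \<in> Fq_ext m"
  using \<theta>_normal by (simp add: normal_in_ext_def)

lemma Fq_ext_m_subset_n: "Fq_ext m \<subseteq> Fq_ext n"
  by (rule Fq_ext_mono[OF m_dvd_n])

text \<open>
  As \<open>r\<close> is prime to \<open>m\<close>, the exponents \<open>r i\<close> run through all residues modulo \<open>m\<close>, so this is the
  normal basis in another order.
\<close>

lemma L_basis_ex1:
  assumes "\<beta> \<in> Fq_ext m"
  shows "\<exists>!x. x \<in> carrier_vec m \<and> \<beta> = (\<Sum>i<m. to_ac (x $ i) * frob (r * i) \<theta>)"
proof -
  let ?s = "\<lambda>i. r * i mod m"
  have bij: "bij_betw ?s {..<m} {..<m}" using coprime_r_m m_pos by (rule bij_betw_mult_mod)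
  have ex: "\<exists>!y. y \<in> carrier_vec m \<and> \<beta> = (\<Sum>i<m. to_ac (y $ i) * frob i \<theta>)"
    using \<theta>_normal assms by (simp add: normal_in_ext_def)
  have reindex: "(\<Sum>i<m. to_ac (y (?s i)) * frob (r * i) \<theta>) = (\<Sum>i<m. to_ac (y i) * frob i \<theta>)" for y
    using sum.reindex_bij_betw[OF bij, of "\<lambda>i. to_ac (y i) * frob i \<theta>"]
    by (simp add: frob_mod[OF \<theta>_in])
  from ex obtain y :: "'k vec" where y: "y \<in> carrier_vec m" "\<beta> = (\<Sum>i<m. to_ac (y $ i) * frob i \<theta>)" by blast
  show ?thesis
  proof (rule ex1I[of _ "vec m (\<lambda>i. y $ ?s i)"])
    show "vec m (\<lambda>i. y $ ?s i) \<in> carrier_vec m \<and>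
        \<beta> = (\<Sum>i<m. to_ac (vec m (\<lambda>i. y $ ?s i) $ i) * frob (r * i) \<theta>)"
      using y(2) reindex[of "\<lambda>i. y $ i"] by simp
  next
    fix x assume x: "x \<in> carrier_vec m \<and> \<beta> = (\<Sum>i<m. to_ac (x $ i) * frob (r * i) \<theta>)"
    let ?y = "\<lambda>j. x $ inv_into {..<m} ?s j"
    have inv: "?y (?s i) = x $ i" if "i < m" for i
      using bij_betw_inv_into_left[OF bij, of i] that by simp
    have "\<beta> = (\<Sum>i<m. to_ac (?y (?s i)) * frob (r * i) \<theta>)" using x inv by simp
    also have "\<dots> = (\<Sum>i<m. to_ac (?y i) * frob i \<theta>)" by (rule reindex)
    also have "\<dots> = (\<Sum>i<m. to_ac (vec m ?y $ i) * frob i \<theta>)" by simp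
    finally have "\<beta> = (\<Sum>i<m. to_ac (vec m ?y $ i) * frob i \<theta>)" .
    with ex y have "vec m ?y = y" by (metis vec_carrier)
    then have "y $ ?s i = x $ i" if "i < m" for i
      using inv[OF that] m_pos by (metis index_vec mod_less_divisor)
    then show "x = vec m (\<lambda>i. y $ ?s i)" using x by (intro eq_vecI) auto
  qed
qed

lemma L_coords_spec:
  assumes "\<beta> \<in> Fq_ext m"
  shows "\<beta> = (\<Sum>i<m. to_ac (L_coords r m \<theta> \<beta> $ i) * frob (r * i) \<theta>)"
  using theI'[OF L_basis_ex1[OF assms]] unfolding L_coords_def by blast

lemma L_coords_unique:
  assumes "\<beta> = (\<Sum>i<m. to_ac (x i) * frob (r * i) \<theta>)" "i < m"
  shows "L_coords r m \<theta> \<beta> $ i = x i"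
proof -
  have "\<beta> \<in> Fq_ext m" unfolding assms(1)
    by (intro Fq_ext_sum Fq_ext_mult Fq_ext_to_ac Fq_ext_frob \<theta>_in)
  from the1_equality[OF L_basis_ex1[OF this], of "vec m x"]
  have "L_coords r m \<theta> \<beta> = vec m x" using assms(1) unfolding L_coords_def by simp
  then show ?thesis using assms(2) by simp
qed

lemma L_coords_lin:
  assumes "\<And>a. a \<in> A \<Longrightarrow> z a \<in> Fq_ext m" "i < m"
  shows "L_coords r m \<theta> (\<Sum>a\<in>A. to_ac (c a) * z a) $ i = (\<Sum>a\<in>A. c a * L_coords r m \<theta> (z a) $ i)"
proof (rule L_coords_unique[OF _ assms(2)])
  let ?x = "\<lambda>a i. L_coords r m \<theta> (z a) $ i"
  have "(\<Sum>a\<in>A. to_ac (c a) * z a)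
      = (\<Sum>a\<in>A. to_ac (c a) * (\<Sum>i<m. to_ac (?x a i) * frob (r * i) \<theta>))"
    using L_coords_spec assms(1) by (intro sum.cong refl) metis
  also have "\<dots> = (\<Sum>i<m. \<Sum>a\<in>A. to_ac (c a * ?x a i) * frob (r * i) \<theta>)"
    by (subst sum.swap) (simp add: sum_distrib_left mult.assoc)
  also have "\<dots> = (\<Sum>i<m. to_ac (\<Sum>a\<in>A. c a * ?x a i) * frob (r * i) \<theta>)"
    by (simp add: to_ac_sum sum_distrib_right)
  finally show "(\<Sum>a\<in>A. to_ac (c a) * z a)
    = (\<Sum>i<m. to_ac (\<Sum>a\<in>A. c a * ?x a i) * frob (r * i) \<theta>)" .
qed

text \<open>
  The \<open>r\<close>-th Frobenius maps \<open>\<theta>^(q^(r i))\<close> to \<open>\<theta>^(q^(r (i+1)))\<close>, and \<open>i\<close> counts modulo \<open>m\<close>.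
\<close>

lemma L_coords_frob:
  assumes "\<beta> \<in> Fq_ext m" "i < m"
  shows "L_coords r m \<theta> (frob r \<beta>) $ ((i + 1) mod m) = L_coords r m \<theta> \<beta> $ i"
proof -
  let ?x = "\<lambda>i. L_coords r m \<theta> \<beta> $ i" and ?s = "\<lambda>i. (i + 1) mod m"
  let ?y = "\<lambda>j. ?x ((j + (m - 1)) mod m)"
  have inv: "(?s i + (m - 1)) mod m = i" if "i < m" for i
  proof -
    have "(?s i + (m - 1)) mod m = (i + 1 + (m - 1)) mod m" by (rule mod_add_left_eq)
    also have "\<dots> = i" using that m_pos by simp
    finally show ?thesis .
  qed
  then have y: "?y (?s i) = ?x i" if "i < m" for i
    using that by (simp only:)
  have "inj_on ?s {..<m}"
    by (rule inj_on_inverseI[of _ "\<lambda>j. (j + (m - 1)) mod m"]) (simp only: inv lessThan_iff)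
  then have bij: "bij_betw ?s {..<m} {..<m}"
    using m_pos by (intro bij_betw_imageI endo_inj_surj) auto
  have "frob r \<beta> = (\<Sum>i<m. frob r (to_ac (?x i) * frob (r * i) \<theta>))"
    by (subst L_coords_spec[OF assms(1)]) (rule frob_sum)
  also have "\<dots> = (\<Sum>i<m. to_ac (?y (?s i)) * frob (r * ?s i) \<theta>)"
  proof (intro sum.cong refl)
    fix i assume "i \<in> {..<m}"
    have "frob (r * ?s i) \<theta> = frob (r * ?s i mod m) \<theta>" by (rule frob_mod[OF \<theta>_in, symmetric])
    also have "\<dots> = frob (r * (i + 1) mod m) \<theta>" by (simp only: mod_mult_right_eq)
    also have "\<dots> = frob (r + r * i) \<theta>" by (simp add: frob_mod[OF \<theta>_in])
    finally show "frob r (to_ac (?x i) * frob (r * i) \<theta>) = to_ac (?y (?s i)) * frob (r * ?s i) \<theta>"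
      using y \<open>i \<in> {..<m}\<close> by simp
  qed
  also have "\<dots> = (\<Sum>i<m. to_ac (?y i) * frob (r * i) \<theta>)"
    by (rule sum.reindex_bij_betw[OF bij])
  finally have "L_coords r m \<theta> (frob r \<beta>) $ ?s i = ?y (?s i)"
    by (rule L_coords_unique) (use m_pos in simp)
  then show ?thesis using y[OF assms(2)] by simp
qed


section \<open>Crossed product coordinates of endomorphisms\<close>

abbreviation idx :: "(nat \<times> nat) set" where
  "idx \<equiv> {..<n} \<times> {..<d}"

text \<open>
  The endomorphism \<open>\<Sum> b(k,l) \<epsilon>\<^sub>l \<pi>^k\<close>, i.e. the image of a coefficient family under the multiplication
  map from \<open>L \<otimes> S\<close> (or from the tensor product of \<open>Fq_ext n\<close> with \<open>S\<close>) to the endomorphism ring.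
\<close>

definition crossed :: "(nat \<times> nat \<Rightarrow> 'k alg_closure) \<Rightarrow> 'k alg_closure \<Rightarrow> 'k alg_closure" where
  "crossed b = (\<lambda>v\<in>M. \<Sum>k<n. \<Sum>l<d. b (k, l) * act (eps l) (frob (r * k) v))"

lemma crossed_closed:
  assumes "b \<in> idx \<rightarrow> Fq_ext n"
  shows "crossed b \<in> carrier E"
  unfolding crossed_def
proof (rule E_restrictI)
  have b: "b (k, l) \<in> Fq_ext n" if "k < n" "l < d" for k l using assms that by auto
  fix v assume v: "v \<in> M"
  show "(\<Sum>k<n. \<Sum>l<d. b (k, l) * act (eps l) (frob (r * k) v)) \<in> M"
    using b v by (intro sum_in_M scalar_in_M act_in_M frob_in_M) auto
  show "(\<Sum>k<n. \<Sum>l<d. b (k, l) * act (eps l) (frob (r * k) (v + w))) =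
      (\<Sum>k<n. \<Sum>l<d. b (k, l) * act (eps l) (frob (r * k) v)) +
      (\<Sum>k<n. \<Sum>l<d. b (k, l) * act (eps l) (frob (r * k) w))" for w
    by (simp add: twist_act_plus distrib_left sum.distrib)
  show "(\<Sum>k<n. \<Sum>l<d. b (k, l) * act (eps l) (frob (r * k) (act a v))) =
      act a (\<Sum>k<n. \<Sum>l<d. b (k, l) * act (eps l) (frob (r * k) v))" for a
  proof -
    have "b (k, l) * act (eps l) (frob (r * k) (act a v))
        = act a (b (k, l) * act (eps l) (frob (r * k) v))" if "k < n" "l < d" for k l
    proof -
      have "act (eps l) (frob (r * k) (act a v)) = act a (act (eps l) (frob (r * k) v))"
        by (simp only: act_frob_mult[symmetric] act_commute)
      then show ?thesis by (simp add: act_scalar[OF b[OF that]])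
    qed
    then show ?thesis by (simp add: twist_act_sum_right)
  qed
qed

lemma S_basis_apply:
  assumes "v \<in> M"
  shows "S_basis \<phi> p r \<epsilon> k l v = act (eps l) (frob (r * k) v)"
  unfolding S_basis_def frob_end_power
  using assms by (simp add: kappa_act_def frob_end_def eps_def frob_in_M)

lemma finsum_eq_crossed:
  assumes "b \<in> idx \<rightarrow> Fq_ext n"
  shows "finsum E (\<lambda>(k, l). L_act \<phi> p (b (k, l)) \<otimes>\<^bsub>E\<^esub> S_basis \<phi> p r \<epsilon> k l) idx = crossed b"
proof (rule E_eqI)
  interpret ring E by (rule ring_E)
  let ?F = "\<lambda>(k, l). L_act \<phi> p (b (k, l)) \<otimes>\<^bsub>E\<^esub> S_basis \<phi> p r \<epsilon> k l"
  have F: "?F i \<in> carrier E" if "i \<in> idx" for i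
    using that assms
    by (auto simp: S_basis_def frob_end_power intro!: E_mult_closed L_act_closed kappa_act_closed frob_end_closed)
  then show "finsum E ?F idx \<in> carrier E" by (intro finsum_closed) auto
  show "crossed b \<in> carrier E" by (rule crossed_closed[OF assms])
  fix v assume v: "v \<in> M"
  have "finsum E ?F idx v = (\<Sum>i\<in>idx. ?F i v)"
    using F v by (intro finsum_E_apply) auto
  also have "\<dots> = (\<Sum>(k, l)\<in>idx. b (k, l) * act (eps l) (frob (r * k) v))"
    using v by (intro sum.cong refl) (auto simp: S_basis_apply L_act_def frob_in_M act_in_M)
  also have "\<dots> = crossed b v"
    using v by (simp add: crossed_def sum.cartesian_product)
  finally show "finsum E ?F idx v = crossed b v" .
qed

text \<open>
  Artin's independence of automorphisms by counting. As \<open>r\<close> is prime to \<open>n\<close>, the \<open>r k\<close> are distinct modulo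
  \<open>n\<close>, so the sum is a twisted polynomial in \<open>\<zeta>\<close> of degree less than \<open>n\<close> that vanishes at \<open>q^n\<close> points.
\<close>

lemma twisted_independent:
  assumes "\<And>\<zeta>. \<zeta> \<in> Fq_ext n \<Longrightarrow> (\<Sum>k<n. frob (r * k) \<zeta> * w k) = 0" "k < n"
  shows "w k = (0 :: 'k alg_closure)"
proof -
  let ?s = "\<lambda>k. r * k mod n"
  have bij: "bij_betw ?s {..<n} {..<n}"
    using coprime_r_n n_pos by (intro bij_betw_mult_mod) auto
  \<comment> \<open>The sum as a twisted polynomial in \<open>\<zeta>\<close>, whose exponents may be reduced modulo \<open>n\<close>.\<close>
  let ?f = "\<Sum>k<n. monom (w k) (?s k)"
  have act: "twist_act ?f \<zeta> = (\<Sum>k<n. frob (r * k) \<zeta> * w k)" if "\<zeta> \<in> Fq_ext n" for \<zeta>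
    by (simp add: twist_act_sum twist_act_monom frob_mod[OF that] mult.commute)
  have deg: "degree ?f < n"
    using n_pos by (intro degree_sum_less) (auto intro: le_less_trans[OF degree_monom_le])
  have "?f = 0"
  proof (rule ccontr)
    assume nz: "?f \<noteq> 0"
    have "card (Fq_ext n :: 'k alg_closure set) \<le> card {v. twist_act ?f v = 0}"
      using twist_act_kernel_card_le(1)[OF nz] assms(1) act by (intro card_mono) auto
    also have "\<dots> \<le> CARD('k) ^ degree ?f" by (rule twist_act_kernel_card_le(2)[OF nz])
    also have "\<dots> < CARD('k) ^ n"
      using deg card_field_gt_1[where 'k='k] by (intro power_strict_increasing) auto
    finally show False using card_Fq_ext(1)[of n, where 'k='k] n_pos by simp
  qed
  then have "0 = coeff ?f (?s k)" by simp
  also have "\<dots> = (\<Sum>j<n. if j = k then w k else 0)"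
    unfolding coeff_sum using assms(2) bij
    by (intro sum.cong) (auto simp: bij_betw_def dest: inj_onD)
  finally show ?thesis using assms(2) by simp
qed

text \<open>
  Testing at \<open>\<zeta> v\<close> for all \<open>\<zeta>\<close> in \<open>Fq_ext n\<close> separates the powers of \<open>\<pi>\<close>. Each of them is bijective on
  \<open>M\<close> and can be removed. What is left is a polynomial in \<open>\<phi>\<^sub>T\<close> that, after reduction of the \<open>\<epsilon>\<^sub>l\<close>, has
  degree less than \<open>d\<close>.
\<close>

lemma crossed_eq_0_imp:
  assumes b: "b \<in> idx \<rightarrow> Fq_ext n" and zero: "\<And>v. v \<in> M \<Longrightarrow> crossed b v = 0"
    and k: "k < n" and l: "l < d"
  shows "b (k, l) = 0"
proof -
  have *: "(\<Sum>l<d. b (k, l) * act (eps l) (frob (r * k) v)) = 0" if v: "v \<in> M" for v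
  proof (rule twisted_independent[OF _ k])
    fix \<zeta> :: "'k alg_closure" assume \<zeta>: "\<zeta> \<in> Fq_ext n"
    have "act (eps l) (frob (r * k) (\<zeta> * v)) = frob (r * k) \<zeta> * act (eps l) (frob (r * k) v)" for k l
      by (simp add: act_scalar Fq_ext_frob[OF \<zeta>])
    then have "(\<Sum>k<n. frob (r * k) \<zeta> * (\<Sum>l<d. b (k, l) * act (eps l) (frob (r * k) v)))
        = crossed b (\<zeta> * v)"
      using scalar_in_M[OF \<zeta> v] by (simp add: crossed_def sum_distrib_left mult.left_commute)
    then show "(\<Sum>k<n. frob (r * k) \<zeta> * (\<Sum>l<d. b (k, l) * act (eps l) (frob (r * k) v))) = 0"
      using zero scalar_in_M[OF \<zeta> v] by simp
  qed
  have zero': "(\<Sum>l<d. b (k, l) * act (eps l) v) = 0" if "v \<in> M" for v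
  proof -
    from that have "v \<in> (\<lambda>v. frob (r * k) v) ` M" by (simp only: frob_image_M)
    then obtain u where "u \<in> M" "v = frob (r * k) u" by blast
    then show ?thesis using * by blast
  qed
  \<comment> \<open>Representatives reduced modulo \<open>p\<close> keep the degree below \<open>d\<close>.\<close>
  let ?W = "\<Sum>l<d. smult (b (k, l)) (map_poly to_ac (eps l mod p))"
  have "?W = 0"
  proof (rule left_eval_eq_0_on_M)
    have "degree (map_poly to_ac (eps l mod p)) < d" for l
      using degree_mod_less'[of p "eps l"] p_nz degree_p_pos
      by (cases "eps l mod p = 0") (auto simp: degree_map_poly)
    then show "degree ?W < d"
      using degree_p_pos by (intro degree_sum_less) (auto intro: le_less_trans[OF degree_smult_le])
    fix v assume v: "v \<in> M"
    have "act (eps l mod p) v = act (eps l) v" for l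
      by (rule act_cong[OF _ v]) (simp add: cong_def)
    then have "left_eval ?W v = (\<Sum>l<d. b (k, l) * act (eps l) v)"
      by (simp add: left_eval_sum left_eval_smult flip: act_left_eval)
    then show "left_eval ?W v = 0" using zero'[OF v] by simp
  qed
  then show ?thesis using l by (rule eps_independent)
qed

lemma crossed_inj:
  assumes b: "b \<in> idx \<rightarrow> Fq_ext n" "b' \<in> idx \<rightarrow> Fq_ext n" and eq: "crossed b = crossed b'"
    and i: "i \<in> idx"
  shows "b i = b' i"
proof -
  obtain k l where kl: "i = (k, l)" "k < n" "l < d" using i by auto
  let ?c = "\<lambda>i. b i - b' i"
  have "?c \<in> idx \<rightarrow> Fq_ext n" using b by (auto intro!: Fq_ext_diff)
  moreover have "crossed ?c v = 0" if "v \<in> M" for v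
  proof -
    have "crossed ?c v = crossed b v - crossed b' v"
      using that by (simp add: crossed_def left_diff_distrib sum_subtractf)
    then show ?thesis using eq by simp
  qed
  ultimately have "?c (k, l) = 0" using kl(2,3) by (rule crossed_eq_0_imp)
  then show ?thesis using kl(1) by simp
qed

text \<open>
  The injective map \<open>crossed\<close> has a domain at least as large as its codomain.
\<close>

lemma crossed_surj_E:
  assumes "f \<in> carrier E"
  obtains b where "b \<in> idx \<rightarrow>\<^sub>E Fq_ext n" "f = crossed b"
proof -
  let ?B = "idx \<rightarrow>\<^sub>E (Fq_ext n :: 'k alg_closure set)"
  have inj: "inj_on crossed ?B"
  proof (rule inj_onI)
    fix b b' assume b: "b \<in> ?B" "b' \<in> ?B" "crossed b = crossed b'"
    then have "b \<in> idx \<rightarrow> Fq_ext n" "b' \<in> idx \<rightarrow> Fq_ext n" by (simp_all add: PiE_def)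
    from crossed_inj[OF this b(3)] show "b = b'" using b(1,2) by (intro PiE_ext)
  qed
  have sub: "crossed ` ?B \<subseteq> carrier E" using crossed_closed by (auto simp: PiE_def)
  have "card (carrier E) \<le> CARD('k) ^ (n * d * n)" by (rule card_E_le)
  also have "\<dots> = card ?B"
    using n_pos by (simp add: card_PiE card_Fq_ext card_cartesian_product mult_ac flip: power_mult)
  also have "\<dots> = card (crossed ` ?B)" using inj by (simp add: card_image)
  finally have "crossed ` ?B = carrier E" using finite_E sub by (intro card_seteq)
  then show ?thesis using assms that by blast
qed

lemma code_ring_carrier_iff:
  "f \<in> carrier (code_ring \<phi> p r m) \<longleftrightarrow> f \<in> carrier E \<and>
     (\<forall>g\<in>kappa_adjoin \<phi> p (frob_end \<phi> p (r * m)). f \<otimes>\<^bsub>E\<^esub> g = g \<otimes>\<^bsub>E\<^esub> f)"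
  by (simp add: code_ring_def centralizer_def frob_end_power)

lemma code_ring_commute:
  assumes "f \<in> carrier (code_ring \<phi> p r m)" "v \<in> M"
  shows "f (frob (r * m) v) = frob (r * m) (f v)"
proof -
  have "frob_end \<phi> p (r * m) \<in> kappa_adjoin \<phi> p (frob_end \<phi> p (r * m))"
    unfolding kappa_adjoin_def by (rule generate_ring.incl) simp
  with assms(1) have f: "f \<in> carrier E"
    and "f \<otimes>\<^bsub>E\<^esub> frob_end \<phi> p (r * m) = frob_end \<phi> p (r * m) \<otimes>\<^bsub>E\<^esub> f"
    unfolding code_ring_carrier_iff by auto
  then have "(f \<otimes>\<^bsub>E\<^esub> frob_end \<phi> p (r * m)) v = (frob_end \<phi> p (r * m) \<otimes>\<^bsub>E\<^esub> f) v" by simp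
  then show ?thesis using assms(2) f by (simp add: frob_end_def E_in_M)
qed

text \<open>
  The commutant of \<open>f\<close> is a subring, so \<open>f\<close> commutes with a generated subring as soon as it commutes with
  the generators, and \<open>\<kappa>\<close> is central.
\<close>

lemma code_ringI:
  assumes f: "f \<in> carrier E" and comm: "\<And>v. v \<in> M \<Longrightarrow> f (frob (r * m) v) = frob (r * m) (f v)"
  shows "f \<in> carrier (code_ring \<phi> p r m)"
proof -
  interpret ring E by (rule ring_E)
  let ?H = "insert (frob_end \<phi> p (r * m)) (range (kappa_act \<phi> p))"
  have H: "?H \<subseteq> carrier E" using frob_end_closed kappa_act_closed by auto
  have "f \<otimes>\<^bsub>E\<^esub> g = g \<otimes>\<^bsub>E\<^esub> f" if "g \<in> generate_ring E ?H" for g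
    using that
  proof (induction rule: generate_ring.induct)
    case (incl h)
    then have "h \<in> carrier E" using H by auto
    then show ?case
    proof (intro E_eqI E_mult_closed f)
      fix v assume v: "v \<in> M"
      show "(f \<otimes>\<^bsub>E\<^esub> h) v = (h \<otimes>\<^bsub>E\<^esub> f) v"
        using incl v comm f by (auto simp: frob_end_def kappa_act_def E_act E_in_M)
    qed
  next
    case (a_inv h)
    then show ?case using f generate_ring_in_carrier[OF H] by (simp add: l_minus r_minus)
  next
    case (eng_add h1 h2)
    then show ?case using f generate_ring_in_carrier[OF H] by (simp add: l_distr r_distr)
  next
    case (eng_mult h1 h2)
    then have c: "h1 \<in> carrier E" "h2 \<in> carrier E" using generate_ring_in_carrier[OF H] by auto
    have "f \<otimes>\<^bsub>E\<^esub> (h1 \<otimes>\<^bsub>E\<^esub> h2) = h1 \<otimes>\<^bsub>E\<^esub> f \<otimes>\<^bsub>E\<^esub> h2"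
      using eng_mult.IH(1) f c by (simp flip: m_assoc)
    also have "\<dots> = h1 \<otimes>\<^bsub>E\<^esub> h2 \<otimes>\<^bsub>E\<^esub> f" using eng_mult.IH(2) f c by (simp add: m_assoc)
    finally show ?case .
  qed (use f in simp)
  then show ?thesis using f unfolding code_ring_carrier_iff kappa_adjoin_def by simp
qed

lemma frob_end_in_code_ring: "frob_end \<phi> p r \<in> carrier (code_ring \<phi> p r m)"
  using frob_end_closed[of 1] frob_in_M by (intro code_ringI) (simp_all add: frob_end_def add.commute)

lemma L_act_in_code_ring:
  assumes "\<zeta> \<in> Fq_ext m"
  shows "L_act \<phi> p \<zeta> \<in> carrier (code_ring \<phi> p r m)"
proof (rule code_ringI)
  show "L_act \<phi> p \<zeta> \<in> carrier E" using assms Fq_ext_m_subset_n by (intro L_act_closed) auto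
  have "frob (r * m) \<zeta> = \<zeta>" using Fq_ext_mult_index[OF assms, of r] by (simp add: mult.commute)
  then show "L_act \<phi> p \<zeta> (frob (r * m) v) = frob (r * m) (L_act \<phi> p \<zeta> v)" if "v \<in> M" for v
    using that frob_in_M[OF that] by (simp add: L_act_def)
qed

text \<open>
  Conjugation by \<open>\<pi>^m\<close> fixes \<open>f\<close> and raises its coordinates to the power \<open>q^(r m)\<close>. By uniqueness the
  coordinates are fixed, so they lie in the intersection of \<open>Fq_ext (r m)\<close> and \<open>Fq_ext n\<close>, which is
  \<open>Fq_ext m\<close>.
\<close>

lemma crossed_surj:
  assumes "f \<in> carrier (code_ring \<phi> p r m)"
  obtains b where "b \<in> idx \<rightarrow>\<^sub>E Fq_ext m" "f = crossed b"
proof -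
  have "f \<in> carrier E" using assms by (simp add: code_ring_carrier_iff)
  then obtain b where b: "b \<in> idx \<rightarrow>\<^sub>E Fq_ext n" "f = crossed b" by (rule crossed_surj_E)
  let ?b = "\<lambda>i. frob (r * m) (b i)"
  have bF: "b \<in> idx \<rightarrow> Fq_ext n" "?b \<in> idx \<rightarrow> Fq_ext n" using b(1) by (auto intro!: Fq_ext_frob)
  have "crossed ?b = crossed b"
  proof (rule E_eqI[OF crossed_closed[OF bF(2)] crossed_closed[OF bF(1)]])
    fix w assume "w \<in> M"
    then obtain v where v: "v \<in> M" "w = frob (r * m) v" using frob_image_M[of m] by blast
    have "crossed ?b w = frob (r * m) (crossed b v)"
      using v frob_in_M by (simp add: crossed_def frob_sum add.commute flip: act_frob_mult)
    then show "crossed ?b w = crossed b w"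
      using code_ring_commute[OF assms v(1)] b(2) v(2) by simp
  qed
  then have fixed: "?b i = b i" if "i \<in> idx" for i using bF that by (intro crossed_inj)
  obtain n' where n': "n = m * n'" using m_dvd_n by (elim dvdE)
  have "coprime r n'" using coprime_r_n n' by simp
  then have gcd: "gcd (r * m) n = m" unfolding n'
    by (metis coprime_iff_gcd_eq_1 gcd_mult_distrib_nat mult.commute mult.right_neutral)
  have "b i \<in> Fq_ext m" if i: "i \<in> idx" for i
  proof -
    have "b i \<in> Fq_ext (r * m)" "b i \<in> Fq_ext n" using fixed[OF i] bF(1) i by (auto simp: Fq_ext_def)
    from Fq_ext_gcd[OF this] show ?thesis by (simp add: gcd)
  qed
  then have "b \<in> idx \<rightarrow>\<^sub>E Fq_ext m" using b(1) by (auto simp: PiE_def)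
  then show ?thesis using b(2) that by blast
qed

lemma L_coeffs_crossed:
  assumes "b \<in> idx \<rightarrow> Fq_ext m" "k < n" "l < d"
  shows "L_coeffs \<phi> p r n m \<epsilon> (crossed b) (k, l) = b (k, l)"
proof -
  have to_n: "c \<in> idx \<rightarrow> Fq_ext n" if "c \<in> idx \<rightarrow> Fq_ext m" for c :: "nat \<times> nat \<Rightarrow> 'k alg_closure"
    using that Fq_ext_m_subset_n by auto
  let ?b = "restrict b idx"
  have b: "?b \<in> idx \<rightarrow>\<^sub>E Fq_ext m" using assms(1) by auto
  have cb: "crossed ?b = crossed b" unfolding crossed_def by (intro restrict_ext sum.cong) auto
  have "L_coeffs \<phi> p r n m \<epsilon> (crossed b) = ?b"
    unfolding L_coeffs_def
  proof (rule the_equality)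
    have "crossed b = finsum E (\<lambda>(k, l). L_act \<phi> p (?b (k, l)) \<otimes>\<^bsub>E\<^esub> S_basis \<phi> p r \<epsilon> k l) idx"
      using finsum_eq_crossed[of ?b] b to_n[of ?b] cb by (simp add: PiE_def)
    with b show "?b \<in> idx \<rightarrow>\<^sub>E Fq_ext m \<and> crossed b =
        finsum E (\<lambda>(k, l). L_act \<phi> p (?b (k, l)) \<otimes>\<^bsub>E\<^esub> S_basis \<phi> p r \<epsilon> k l) idx" ..
  next
    fix c assume c: "c \<in> idx \<rightarrow>\<^sub>E Fq_ext m \<and> crossed b =
        finsum E (\<lambda>(k, l). L_act \<phi> p (c (k, l)) \<otimes>\<^bsub>E\<^esub> S_basis \<phi> p r \<epsilon> k l) idx"
    then have "c \<in> idx \<rightarrow> Fq_ext n" using to_n by (simp add: PiE_def)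
    with c have "crossed c = crossed b" using finsum_eq_crossed[of c] by simp
    then have "c i = b i" if "i \<in> idx" for i
      using crossed_inj[OF \<open>c \<in> idx \<rightarrow> Fq_ext n\<close> to_n[OF assms(1)]] that by blast
    then show "c = ?b" using c by (intro PiE_ext[OF _ b]) auto
  qed
  then show ?thesis using assms(2,3) by simp
qed

end

section \<open>Matrices and the cyclic shift\<close>

lemma mult_mat_index_sum:
  assumes "A \<in> carrier_mat a b" "B \<in> carrier_mat b c" "i < a" "j < c"
  shows "(A * B) $$ (i, j) = (\<Sum>h<b. A $$ (i, h) * B $$ (h, j))"
  using assms by (auto simp: scalar_prod_def atLeast0LessThan intro!: sum.cong)

lemma invertible_matI_left:
  assumes "A \<in> carrier_mat N N" "B \<in> carrier_mat N N" "B * A = 1\<^sub>m N"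
  shows "invertible_mat (A :: 'a :: field mat)"
  using assms mat_mult_left_right_inverse[OF assms(2,1,3)]
  by (auto simp: invertible_mat_def inverts_mat_def intro!: exI[of _ B])

lemma sum_div_mod:
  assumes "d > (0::nat)"
  shows "(\<Sum>h<n * d. F (h div d) (h mod d)) = (\<Sum>k<n. \<Sum>l<d. F k l)"
proof -
  have "(\<Sum>h<n * d. F (h div d) (h mod d)) = (\<Sum>(k, l)\<in>{..<n} \<times> {..<d}. F k l)"
  proof (rule sum.reindex_bij_witness[of _ "\<lambda>(k, l). k * d + l" "\<lambda>h. (h div d, h mod d)"])
    fix a assume "a \<in> {..<n} \<times> {..<d}"
    then obtain k l where a: "a = (k, l)" "k < n" "l < d" by auto
    have "k * d + l < Suc k * d" using a(3) by simp
    also have "\<dots> \<le> n * d" using a(2) by (intro mult_le_mono1) simp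
    finally show "(case a of (k, l) \<Rightarrow> k * d + l) \<in> {..<n * d}" using a(1) by simp
  qed (use assms in \<open>auto simp: less_mult_imp_div_less\<close>)
  then show ?thesis by (simp add: sum.cartesian_product)
qed

lemma inj_on_cyclic_shift: "inj_on (\<lambda>i. (i + 1) mod m) {..<m :: nat}"
proof (rule inj_onI)
  fix i j assume ij: "i \<in> {..<m}" "j \<in> {..<m}" "(i + 1) mod m = (j + 1) mod m"
  then have "[i = j] (mod m)" using cong_add_rcancel_nat[of i 1 j m] by (simp add: cong_def)
  then show "i = j" using ij by (simp add: cong_def)
qed

lemma cyclic_shift_surj:
  assumes "i < (m :: nat)"
  obtains j where "j < m" "i = (j + 1) mod m"
proof -
  have "(\<lambda>i. (i + 1) mod m) ` {..<m} = {..<m}"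
    using assms by (intro endo_inj_surj inj_on_cyclic_shift) auto
  then have "i \<in> (\<lambda>i. (i + 1) mod m) ` {..<m}" using assms by simp
  then show ?thesis using that by auto
qed

lemma shift_mat_mult_index:
  assumes "Y \<in> carrier_mat m c" "i < m" "j < c"
  shows "(shift_mat m * Y) $$ ((i + 1) mod m, j) = Y $$ (i, j)"
proof -
  have "(shift_mat m * Y) $$ ((i + 1) mod m, j)
      = (\<Sum>h<m. shift_mat m $$ ((i + 1) mod m, h) * Y $$ (h, j))"
    using assms by (intro mult_mat_index_sum[of _ m]) (auto simp: shift_mat_def)
  also have "\<dots> = (\<Sum>h<m. if h = i then Y $$ (i, j) else 0)"
  proof (intro sum.cong refl)
    fix h assume h: "h \<in> {..<m}"
    then have "shift_mat m $$ ((i + 1) mod m, h) = (if (i + 1) mod m = (h + 1) mod m then 1 else 0)"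
      using assms(2) by (simp add: shift_mat_def)
    also have "(i + 1) mod m = (h + 1) mod m \<longleftrightarrow> h = i"
      using inj_on_cyclic_shift[of m] h assms(2) by (auto dest: inj_onD)
    finally have entry: "shift_mat m $$ ((i + 1) mod m, h) = (if h = i then 1 else 0)" .
    show "shift_mat m $$ ((i + 1) mod m, h) * Y $$ (h, j) = (if h = i then Y $$ (i, j) else 0)"
      unfolding entry by simp
  qed
  finally show ?thesis using assms(2) by simp
qed

lemma invertible_shift_mat: "invertible_mat (shift_mat m :: 'k :: {field, finite} mat)"
proof -
  let ?Y = "mat m m (\<lambda>(i, j). if j = (i + 1) mod m then 1 else 0) :: 'k mat"
  have Q: "shift_mat m \<in> carrier_mat m m" and Y: "?Y \<in> carrier_mat m m" by (auto simp: shift_mat_def)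
  have "shift_mat m * ?Y = 1\<^sub>m m"
  proof (rule eq_matI)
    fix i j assume ij: "i < dim_row (1\<^sub>m m :: 'k mat)" "j < dim_col (1\<^sub>m m :: 'k mat)"
    then obtain h where h: "h < m" "i = (h + 1) mod m" using cyclic_shift_surj[of i m] by auto
    show "(shift_mat m * ?Y) $$ (i, j) = 1\<^sub>m m $$ (i, j)"
      using shift_mat_mult_index[OF Y h(1), of j] ij h by auto
  qed (use Q Y in auto)
  then have "?Y * shift_mat m = 1\<^sub>m m" by (rule mat_mult_left_right_inverse[OF Q Y])
  with Q Y show ?thesis by (rule invertible_matI_left)
qed

context drinfeld_bases
begin

section \<open>Multiplication by Frobenius and by scalars in coordinates\<close>

text \<open>
  The coefficients of \<open>\<pi> f\<close> in terms of those of \<open>f\<close>. The case \<open>k = 0\<close> collects the terms with \<open>\<pi>^n = c\<close>.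
\<close>

definition pi_coeffs :: "(nat \<times> nat \<Rightarrow> 'k alg_closure) \<Rightarrow> nat \<times> nat \<Rightarrow> 'k alg_closure" where
  "pi_coeffs b = (\<lambda>(k, l). if k = 0
     then \<Sum>l'<d. to_ac (kappa_coords p \<epsilon> (p0 * eps l') $ l) * frob r (b (n - 1, l'))
     else frob r (b (k - 1, l)))"

lemma pi_coeffs_in:
  assumes "b \<in> idx \<rightarrow> Fq_ext m"
  shows "pi_coeffs b \<in> idx \<rightarrow> Fq_ext m"
proof -
  have "b (n - 1, l) \<in> Fq_ext m" "b (k - 1, l) \<in> Fq_ext m" if "k < n" "l < d" for k l
    using assms that n_pos by (auto simp: Pi_iff)
  then show ?thesis
    using n_pos by (auto simp: pi_coeffs_def intro!: Fq_ext_sum Fq_ext_mult Fq_ext_frob)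
qed

lemma Fq_ext_m_valued_imp_n: "b \<in> idx \<rightarrow> Fq_ext m \<Longrightarrow> b \<in> idx \<rightarrow> Fq_ext n"
  using Fq_ext_m_subset_n by auto

lemma frob_end_mult_crossed:
  assumes "b \<in> idx \<rightarrow> Fq_ext m"
  shows "frob_end \<phi> p r \<otimes>\<^bsub>E\<^esub> crossed b = crossed (pi_coeffs b)"
proof (rule E_eqI)
  have c: "crossed b \<in> carrier E" using assms by (intro crossed_closed Fq_ext_m_valued_imp_n)
  then show "frob_end \<phi> p r \<otimes>\<^bsub>E\<^esub> crossed b \<in> carrier E"
    using frob_end_closed[of 1] by (intro E_mult_closed) simp_all
  show "crossed (pi_coeffs b) \<in> carrier E"
    by (intro crossed_closed Fq_ext_m_valued_imp_n pi_coeffs_in assms)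
  fix v assume v: "v \<in> M"
  obtain N where N: "n = Suc N" using n_pos by (cases n) auto
  have n1: "n - 1 = N" by (simp add: N)
  have first: "(\<Sum>k<n. F k) = F 0 + (\<Sum>k<N. F (Suc k))"
    and last: "(\<Sum>k<n. F k) = (\<Sum>k<N. F k) + F N" for F :: "nat \<Rightarrow> 'k alg_closure"
    unfolding N by (rule sum.lessThan_Suc_shift, rule sum.lessThan_Suc)
  \<comment> \<open>\<open>?g k\<close> is what the \<open>k\<close>-th power of \<open>\<pi>\<close> in \<open>f\<close> contributes to \<open>\<pi> f\<close>, and \<open>?h k\<close> is the term with
    the \<open>k\<close>-th power in the claimed expansion; \<open>?g k\<close> is \<open>?h (k + 1)\<close>, except that \<open>?g (n - 1)\<close> is \<open>?h 0\<close>.\<close>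
  let ?g = "\<lambda>k. \<Sum>l<d. frob r (b (k, l)) * act (eps l) (frob (r * Suc k) v)"
  let ?h = "\<lambda>k. \<Sum>l<d. pi_coeffs b (k, l) * act (eps l) (frob (r * k) v)"
  let ?K = "\<lambda>l l'. kappa_coords p \<epsilon> (p0 * eps l) $ l'"
  have top: "act (eps l) (frob (r * n) v) = (\<Sum>l'<d. to_ac (?K l l') * act (eps l') v)" for l
  proof -
    have "act (eps l) (frob (r * n) v) = act (p0 * eps l) v"
      by (simp only: act_p0[symmetric] act_mult act_commute)
    also have "\<dots> = act (\<Sum>l'<d. smult (?K l l') (eps l')) v"
      by (rule act_cong[OF kappa_coords_spec(2) v])
    finally show ?thesis by (simp add: act_sum act_smult)
  qed
  have "?g N = (\<Sum>l<d. \<Sum>l'<d. to_ac (?K l l') * frob r (b (N, l)) * act (eps l') v)"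
    unfolding N[symmetric] top by (simp add: sum_distrib_left mult_ac)
  also have "\<dots> = ?h 0"
    by (subst sum.swap) (simp add: pi_coeffs_def n1[simplified] sum_distrib_right)
  finally have "?g N = ?h 0" .
  moreover have "?g k = ?h (Suc k)" for k by (simp add: pi_coeffs_def)
  ultimately have "(\<Sum>k<n. ?g k) = (\<Sum>k<n. ?h k)"
    unfolding first[of ?h] last[of ?g] by (simp only: add.commute)
  moreover have "(frob_end \<phi> p r \<otimes>\<^bsub>E\<^esub> crossed b) v = (\<Sum>k<n. ?g k)"
  proof -
    have "frob r (act (eps l) (frob (r * k) v)) = act (eps l) (frob (r * Suc k) v)" for k l
      by (simp flip: act_frob)
    then show ?thesis using v E_in_M[OF c v] by (simp add: frob_end_def crossed_def frob_sum)
  qed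
  ultimately show "(frob_end \<phi> p r \<otimes>\<^bsub>E\<^esub> crossed b) v = crossed (pi_coeffs b) v"
    using v by (simp add: crossed_def)
qed

lemma L_act_mult_crossed:
  assumes "b \<in> idx \<rightarrow> Fq_ext m" "\<zeta> \<in> Fq_ext m"
  shows "L_act \<phi> p \<zeta> \<otimes>\<^bsub>E\<^esub> crossed b = crossed (\<lambda>i. \<zeta> * b i)"
proof (rule E_eqI)
  have c: "crossed b \<in> carrier E" using assms by (intro crossed_closed Fq_ext_m_valued_imp_n)
  then show "L_act \<phi> p \<zeta> \<otimes>\<^bsub>E\<^esub> crossed b \<in> carrier E"
    using assms(2) Fq_ext_m_subset_n by (intro E_mult_closed L_act_closed) auto
  show "crossed (\<lambda>i. \<zeta> * b i) \<in> carrier E"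
    using assms by (intro crossed_closed Fq_ext_m_valued_imp_n) (auto intro!: Fq_ext_mult)
  show "(L_act \<phi> p \<zeta> \<otimes>\<^bsub>E\<^esub> crossed b) v = crossed (\<lambda>i. \<zeta> * b i) v" if "v \<in> M" for v
    using that E_in_M[OF c that] by (simp add: L_act_def crossed_def sum_distrib_left mult.assoc)
qed

abbreviation matrix_of where "matrix_of \<equiv> code_mat \<phi> p r n m \<theta> \<epsilon>"

lemma matrix_of_carrier: "matrix_of f \<in> carrier_mat m (n * d)"
  by (simp add: code_mat_def)

lemma matrix_of_crossed:
  assumes "b \<in> idx \<rightarrow> Fq_ext m" "i < m" "j < n * d"
  shows "matrix_of (crossed b) $$ (i, j) = L_coords r m \<theta> (b (j div d, j mod d)) $ i"
  using assms L_coeffs_crossed[OF assms(1), of "j div d" "j mod d"] degree_p_pos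
  by (simp add: code_mat_def less_mult_imp_div_less)

lemma T_mat_carrier: "T_mat p0 p n \<epsilon> \<in> carrier_mat (n * d) (n * d)"
  by (simp add: T_mat_def Let_def)

text \<open>
  A row vector times \<open>T\<close>: the blocks move one step to the right, and the last block is multiplied by \<open>c\<close>
  and becomes the first.
\<close>

lemma sum_mult_T_mat:
  assumes "j < n * d"
  shows "(\<Sum>h<n * d. F (h div d) (h mod d) * T_mat p0 p n \<epsilon> $$ (h, j)) =
    (if j div d = 0 then \<Sum>l<d. F (n - 1) l * kappa_coords p \<epsilon> (p0 * eps l) $ (j mod d)
     else F (j div d - 1) (j mod d))"
proof -
  define k' l' where "k' = j div d" and "l' = j mod d"
  have k': "k' < n" using assms by (simp add: k'_def less_mult_imp_div_less)
  have l': "l' < d" using degree_p_pos by (simp add: l'_def)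
  let ?T = "\<lambda>k l. if k' = k + 1 then (if l = l' then 1 else 0)
    else if k = n - 1 \<and> k' = 0 then kappa_coords p \<epsilon> (p0 * eps l) $ l' else 0"
  have "(\<Sum>h<n * d. F (h div d) (h mod d) * T_mat p0 p n \<epsilon> $$ (h, j))
      = (\<Sum>h<n * d. F (h div d) (h mod d) * ?T (h div d) (h mod d))"
    using assms by (intro sum.cong refl) (simp add: T_mat_def Let_def eps_def k'_def l'_def)
  also have "\<dots> = (\<Sum>k<n. \<Sum>l<d. F k l * ?T k l)"
    using sum_div_mod[OF degree_p_pos, of "\<lambda>k l. F k l * ?T k l"] .
  also have "\<dots> = (if k' = 0 then \<Sum>l<d. F (n - 1) l * kappa_coords p \<epsilon> (p0 * eps l) $ l'
     else F (k' - 1) l')"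
  proof (cases "k' = 0")
    case True
    have "(\<Sum>k<n. \<Sum>l<d. F k l * ?T k l)
        = (\<Sum>k<n. if k = n - 1 then \<Sum>l<d. F (n - 1) l * kappa_coords p \<epsilon> (p0 * eps l) $ l' else 0)"
      using True by (intro sum.cong) auto
    then show ?thesis using True n_pos by simp
  next
    case False
    then have "F k l * ?T k l = (if l = l' then if k = k' - 1 then F (k' - 1) l' else 0 else 0)" for k l
      by auto
    then have "(\<Sum>k<n. \<Sum>l<d. F k l * ?T k l) = (\<Sum>k<n. if k = k' - 1 then F (k' - 1) l' else 0)"
      using l' by (simp only: sum.delta finite_lessThan lessThan_iff if_True)
    then show ?thesis using False k' by simp
  qed
  finally show ?thesis by (simp add: k'_def l'_def)
qed

text \<open>
  The inverse moves the blocks one step to the left and multiplies the first block by \<open>c^(-1)\<close> on its way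
  to the last place.
\<close>

lemma invertible_T_mat: "invertible_mat (T_mat p0 p n \<epsilon>)"
proof -
  obtain u where u: "[u * p0 = 1] (mod p)"
    using irreducible_poly_inverse_mod[OF p_irreducible p_not_dvd_p0] .
  let ?N = "n * d"
  \<comment> \<open>The entry of the inverse in row \<open>(k0, l0)\<close> and column \<open>(k, l)\<close>; \<open>u\<close> represents \<open>c^(-1)\<close>.\<close>
  define F where "F k0 l0 k l = (if k0 = 0 then if k = n - 1 then kappa_coords p \<epsilon> (u * eps l0) $ l else 0
    else if k0 = k + 1 \<and> l0 = l then 1 else 0)" for k0 l0 k l
  define U where "U = mat ?N ?N (\<lambda>(i, h). F (i div d) (i mod d) (h div d) (h mod d))"
  have U: "U \<in> carrier_mat ?N ?N" by (simp add: U_def)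
  have "U * T_mat p0 p n \<epsilon> = 1\<^sub>m ?N"
  proof (rule eq_matI)
    fix i j assume "i < dim_row (1\<^sub>m ?N :: 'k mat)" "j < dim_col (1\<^sub>m ?N :: 'k mat)"
    then have ij: "i < ?N" "j < ?N" by auto
    have lt: "i div d < n" "j div d < n" "i mod d < d" "j mod d < d"
      using ij degree_p_pos by (auto simp: less_mult_imp_div_less)
    have "(U * T_mat p0 p n \<epsilon>) $$ (i, j) = (\<Sum>h<?N. U $$ (i, h) * T_mat p0 p n \<epsilon> $$ (h, j))"
      by (rule mult_mat_index_sum[OF U T_mat_carrier ij])
    also have "\<dots> = (\<Sum>h<?N. F (i div d) (i mod d) (h div d) (h mod d) * T_mat p0 p n \<epsilon> $$ (h, j))"
      using ij by (intro sum.cong) (simp_all add: U_def)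
    also have "\<dots> = (if i div d = j div d \<and> i mod d = j mod d then 1 else 0)"
      unfolding sum_mult_T_mat[OF ij(2)]
      using lt n_pos kappa_coords_matrix_mult[OF u lt(3,4)] by (auto simp: F_def)
    also have "\<dots> = 1\<^sub>m ?N $$ (i, j)"
      using ij by (auto simp: one_mat_def) (metis div_mult_mod_eq)
    finally show "(U * T_mat p0 p n \<epsilon>) $$ (i, j) = 1\<^sub>m ?N $$ (i, j)" .
  qed (use U T_mat_carrier in auto)
  with T_mat_carrier U show ?thesis by (rule invertible_matI_left)
qed

lemma matrix_of_frob_end_mult:
  assumes "f \<in> carrier (code_ring \<phi> p r m)"
  shows "matrix_of (frob_end \<phi> p r \<otimes>\<^bsub>E\<^esub> f) = shift_mat m * matrix_of f * T_mat p0 p n \<epsilon>"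
proof -
  obtain b where "b \<in> idx \<rightarrow>\<^sub>E Fq_ext m" and f: "f = crossed b" using crossed_surj[OF assms] .
  then have b: "b \<in> idx \<rightarrow> Fq_ext m" by (simp add: PiE_def)
  let ?T = "T_mat p0 p n \<epsilon>"
  have Q: "(shift_mat m :: 'k mat) \<in> carrier_mat m m" by (simp add: shift_mat_def)
  have AT: "matrix_of f * ?T \<in> carrier_mat m (n * d)"
    using matrix_of_carrier T_mat_carrier by (rule mult_carrier_mat)
  have "matrix_of (crossed (pi_coeffs b)) = shift_mat m * (matrix_of f * ?T)"
  proof (rule eq_matI)
    fix i j assume "i < dim_row (shift_mat m * (matrix_of f * ?T))" "j < dim_col (shift_mat m * (matrix_of f * ?T))"
    then have ij: "i < m" "j < n * d"
      using carrier_matD[OF Q] carrier_matD[OF T_mat_carrier] by simp_all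
    obtain h where h: "h < m" "i = (h + 1) mod m" using cyclic_shift_surj[OF ij(1)] .
    have lt: "j div d < n" "j mod d < d" using ij degree_p_pos by (auto simp: less_mult_imp_div_less)
    have "(shift_mat m * (matrix_of f * ?T)) $$ (i, j) = (matrix_of f * ?T) $$ (h, j)"
      unfolding h(2) by (rule shift_mat_mult_index[OF AT h(1) ij(2)])
    also have "\<dots> = (\<Sum>g<n * d. matrix_of f $$ (h, g) * ?T $$ (g, j))"
      by (rule mult_mat_index_sum[OF matrix_of_carrier T_mat_carrier h(1) ij(2)])
    also have "\<dots> = (\<Sum>g<n * d. L_coords r m \<theta> (b (g div d, g mod d)) $ h * ?T $$ (g, j))"
      using h(1) by (intro sum.cong) (simp_all add: f matrix_of_crossed[OF b])
    also have "\<dots> = L_coords r m \<theta> (pi_coeffs b (j div d, j mod d)) $ i"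
    proof (cases "j div d = 0")
      case True
      have bn: "b (n - 1, l) \<in> Fq_ext m" if "l < d" for l using b that n_pos by auto
      have "L_coords r m \<theta> (pi_coeffs b (j div d, j mod d)) $ i
          = (\<Sum>l<d. kappa_coords p \<epsilon> (p0 * eps l) $ (j mod d) * L_coords r m \<theta> (frob r (b (n - 1, l))) $ i)"
        unfolding pi_coeffs_def True prod.case if_P[OF refl]
        using bn ij(1) by (intro L_coords_lin Fq_ext_frob) simp_all
      also have "\<dots> = (\<Sum>l<d. L_coords r m \<theta> (b (n - 1, l)) $ h * kappa_coords p \<epsilon> (p0 * eps l) $ (j mod d))"
        unfolding h(2) using bn h(1) by (intro sum.cong refl) (simp only: L_coords_frob lessThan_iff mult.commute)
      finally show ?thesis
        using sum_mult_T_mat[OF ij(2), of "\<lambda>k l. L_coords r m \<theta> (b (k, l)) $ h"] True by simp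
    next
      case False
      have "b (j div d - 1, j mod d) \<in> Fq_ext m" using b lt by auto
      from L_coords_frob[OF this h(1)] show ?thesis
        using sum_mult_T_mat[OF ij(2), of "\<lambda>k l. L_coords r m \<theta> (b (k, l)) $ h"] False
        by (simp add: pi_coeffs_def h(2))
    qed
    also have "\<dots> = matrix_of (crossed (pi_coeffs b)) $$ (i, j)"
      by (rule matrix_of_crossed[OF pi_coeffs_in[OF b] ij, symmetric])
    finally show "matrix_of (crossed (pi_coeffs b)) $$ (i, j) = (shift_mat m * (matrix_of f * ?T)) $$ (i, j)" ..
  qed (use matrix_of_carrier[of "crossed (pi_coeffs b)"] Q AT in auto)
  also have "\<dots> = shift_mat m * matrix_of f * ?T"
    by (rule assoc_mult_mat[OF Q matrix_of_carrier T_mat_carrier, symmetric])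
  finally show ?thesis by (simp add: f frob_end_mult_crossed[OF b])
qed

lemma matrix_of_L_act_mult:
  assumes "f \<in> carrier (code_ring \<phi> p r m)" "\<zeta> \<in> Fq_ext m"
  shows "matrix_of (L_act \<phi> p \<zeta> \<otimes>\<^bsub>E\<^esub> f) = L_mult_mat r m \<theta> \<zeta> * matrix_of f"
proof -
  obtain b where "b \<in> idx \<rightarrow>\<^sub>E Fq_ext m" and f: "f = crossed b" using crossed_surj[OF assms(1)] .
  then have b: "b \<in> idx \<rightarrow> Fq_ext m" by (simp add: PiE_def)
  have zb: "(\<lambda>i. \<zeta> * b i) \<in> idx \<rightarrow> Fq_ext m" using b assms(2) by (auto intro!: Fq_ext_mult)
  have Z: "L_mult_mat r m \<theta> \<zeta> \<in> carrier_mat m m" by (simp add: L_mult_mat_def)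
  have "matrix_of (crossed (\<lambda>i. \<zeta> * b i)) = L_mult_mat r m \<theta> \<zeta> * matrix_of f"
  proof (rule eq_matI)
    fix i j assume "i < dim_row (L_mult_mat r m \<theta> \<zeta> * matrix_of f)" "j < dim_col (L_mult_mat r m \<theta> \<zeta> * matrix_of f)"
    then have ij: "i < m" "j < n * d" using Z matrix_of_carrier[of f] by auto
    let ?\<beta> = "b (j div d, j mod d)"
    have \<beta>: "?\<beta> \<in> Fq_ext m" using b ij degree_p_pos by (auto simp: less_mult_imp_div_less)
    have "\<zeta> * ?\<beta> = (\<Sum>h<m. to_ac (L_coords r m \<theta> ?\<beta> $ h) * (\<zeta> * frob (r * h) \<theta>))"
      by (subst L_coords_spec[OF \<beta>]) (simp add: sum_distrib_left mult_ac)
    then have "L_coords r m \<theta> (\<zeta> * ?\<beta>) $ i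
        = (\<Sum>h<m. L_coords r m \<theta> ?\<beta> $ h * L_coords r m \<theta> (\<zeta> * frob (r * h) \<theta>) $ i)"
      using L_coords_lin[OF _ ij(1), of "{..<m}" "\<lambda>h. \<zeta> * frob (r * h) \<theta>"]
      by (simp add: Fq_ext_mult[OF assms(2)] Fq_ext_frob[OF \<theta>_in])
    also have "\<dots> = (\<Sum>h<m. L_mult_mat r m \<theta> \<zeta> $$ (i, h) * matrix_of f $$ (h, j))"
      using ij by (intro sum.cong refl) (simp add: f matrix_of_crossed[OF b] L_mult_mat_def mult.commute)
    also have "\<dots> = (L_mult_mat r m \<theta> \<zeta> * matrix_of f) $$ (i, j)"
      by (rule mult_mat_index_sum[OF Z matrix_of_carrier ij, symmetric])
    finally show "matrix_of (crossed (\<lambda>i. \<zeta> * b i)) $$ (i, j) = (L_mult_mat r m \<theta> \<zeta> * matrix_of f) $$ (i, j)"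
      by (simp add: matrix_of_crossed[OF zb ij])
  qed (use matrix_of_carrier[of "crossed (\<lambda>i. \<zeta> * b i)"] matrix_of_carrier[of f] Z in auto)
  then show ?thesis by (simp add: f L_act_mult_crossed[OF b assms(2)])
qed

end

theorem proposition6p4:
  fixes p0 p \<epsilon> :: "'k :: {field, finite} poly"
    and t \<theta> :: "'k alg_closure"
    and \<phi> :: "'k poly \<Rightarrow> 'k alg_closure poly"
    and n m r :: nat
  assumes "n \<ge> 1"
    and "lead_coeff p0 = 1" and "irreducible p0" and "degree p0 = r" and "gcd n r = 1"
    and "t \<in> Fq_ext r" and "poly (map_poly to_ac p0) t = 0"
    and "is_drinfeld_module r n t \<phi>"
    and "lead_coeff p = 1" and "irreducible p" and "p \<noteq> p0"
    and "m dvd n"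
    and "normal_in_ext m \<theta>"
    and "normal_mod p \<epsilon>"
  defines "E \<equiv> End_tors \<phi> p"
    and "\<pi> \<equiv> frob_end \<phi> p r"
    and "R \<equiv> code_ring \<phi> p r m"
    and "\<A> \<equiv> code_mat \<phi> p r n m \<theta> \<epsilon>"
    and "Q \<equiv> (shift_mat m :: 'k mat)"
    and "T \<equiv> T_mat p0 p n \<epsilon>"
  shows "(\<forall>f\<in>carrier R. \<A> (\<pi> \<otimes>\<^bsub>E\<^esub> f) = Q * \<A> f * T) \<and>
         invertible_mat Q \<and> invertible_mat T \<and>
         (\<forall>C. left_ideal C R \<longrightarrow>
            (\<forall>B\<in>\<A> ` C. Q * B * T \<in> \<A> ` C) \<and>
            (\<forall>\<zeta>\<in>Fq_ext m. \<forall>B\<in>\<A> ` C. L_mult_mat r m \<theta> \<zeta> * B \<in> \<A> ` C))"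
proof -
  interpret drinfeld_bases p0 p t \<phi> n r m \<theta> \<epsilon>
    using assms(1-14) by unfold_locales
  have mult_R: "g \<otimes>\<^bsub>R\<^esub> f = g \<otimes>\<^bsub>E\<^esub> f" for f g
    by (simp add: R_def E_def code_ring_def centralizer_def)
  have shift: "\<A> (\<pi> \<otimes>\<^bsub>E\<^esub> f) = Q * \<A> f * T" if "f \<in> carrier R" for f
    using matrix_of_frob_end_mult that unfolding \<A>_def \<pi>_def E_def Q_def T_def R_def by blast
  have scale: "\<A> (L_act \<phi> p \<zeta> \<otimes>\<^bsub>E\<^esub> f) = L_mult_mat r m \<theta> \<zeta> * \<A> f"
    if "f \<in> carrier R" "\<zeta> \<in> Fq_ext m" for f \<zeta>
    using matrix_of_L_act_mult that unfolding \<A>_def E_def R_def by blast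
  have \<pi>: "\<pi> \<in> carrier R" unfolding \<pi>_def R_def by (rule frob_end_in_code_ring)
  have L: "L_act \<phi> p \<zeta> \<in> carrier R" if "\<zeta> \<in> Fq_ext m" for \<zeta>
    unfolding R_def by (rule L_act_in_code_ring[OF that])
  have code: "Q * \<A> f * T \<in> \<A> ` C" "\<forall>\<zeta>\<in>Fq_ext m. L_mult_mat r m \<theta> \<zeta> * \<A> f \<in> \<A> ` C"
    if C: "left_ideal C R" and f: "f \<in> C" for C f
  proof -
    have "C \<subseteq> carrier R"
      using C unfolding left_ideal_def by (metis additive_subgroup.a_subset)
    with f have fR: "f \<in> carrier R" by blast
    have closed: "g \<otimes>\<^bsub>E\<^esub> f \<in> C" if "g \<in> carrier R" for g
      using C f that unfolding left_ideal_def mult_R by blast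
    show "Q * \<A> f * T \<in> \<A> ` C"
      using closed[OF \<pi>] unfolding shift[OF fR, symmetric] by (rule imageI)
    show "\<forall>\<zeta>\<in>Fq_ext m. L_mult_mat r m \<theta> \<zeta> * \<A> f \<in> \<A> ` C"
    proof
      fix \<zeta> :: "'k alg_closure" assume \<zeta>: "\<zeta> \<in> Fq_ext m"
      show "L_mult_mat r m \<theta> \<zeta> * \<A> f \<in> \<A> ` C"
        using closed[OF L[OF \<zeta>]] unfolding scale[OF fR \<zeta>, symmetric] by (rule imageI)
    qed
  qed
  show ?thesis
    using shift code invertible_shift_mat invertible_T_mat unfolding Q_def T_def by blast
qed

end
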